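(* Let $p>0$. If $\Psi\in L^{\infty}(\mathbb{R})$ is a real-valued, odd, $p$-periodic function with $\|\Psi\|_{\infty}\le 1/2$, then $$S(w)=\frac{1}{2}\int_{\mathbb{R}}\frac{\Psi(\lambda)\sinh\left(\frac{w}{2}\right)}{\cosh\left(\frac{\lambda}{2}\right)\cosh\left(\frac{w-\lambda}{2}\right)}\,d\lambda,\qquad w\in D,$$ is a function belonging to $\mathcal{W}_p$. The map $\Psi\mapsto S$ defines a bijection between the class of all such functions $\Psi$ in $L^{\infty}(\mathbb{R})$ (functions equal almost everywhere being identified) and the set $\mathcal{W}_p$. In particular, if $S\in\mathcal{W}_p$, then $\Psi$ can be uniquely recovered by the formula $$\Psi(\lambda)=\frac{1}{\pi}\lim_{\mu\to\pi^{-}}\operatorname{Im}S(\lambda+i\mu),\qquad\text{for Lebesgue a.e. }\lambda\in\mathbb{R}.$$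
   Context: $D=\{w\in\mathbb{C}:-\pi<\operatorname{Im}w<\pi\}$. For $p>0$, $\mathcal{W}_p$ denotes the set of all analytic functions $S:D\to\mathbb{C}$ such that: (i) $|\operatorname{Im}S(w)|\le\frac12\operatorname{Im}w$ whenever $0\le\operatorname{Im}w<\pi$; (ii) $S(0)=0$; (iii) $S(-w)=S(w)$ for all $w\in D$; (iv) $S(w+p)=S(w)$ for all $w\in D$. Oddness and periodicity of elements of $L^\infty(\mathbb{R})$ are understood almost everywhere. *)

theory Defs
  imports "HOL-Probability.Essential_Supremum"
begin

definition strip :: "complex set" where
  "strip = {w. - pi < Im w \<and> Im w < pi}"

(* Functions with domain D are represented extensionally (value undefined outside D), so that
   equality of elements of W p is equality of functions on D. *)
definition W :: "real \<Rightarrow> (complex \<Rightarrow> complex) set" where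
  "W p = {S. S \<in> extensional strip \<and> S analytic_on strip \<and>
     (\<forall>w. 0 \<le> Im w \<and> Im w < pi \<longrightarrow> \<bar>Im (S w)\<bar> \<le> 1 / 2 * Im w) \<and>
     S 0 = 0 \<and>
     (\<forall>w\<in>strip. S (- w) = S w) \<and>
     (\<forall>w\<in>strip. S (w + of_real p) = S w)}"

(* esssup takes the value infinity on non-measurable functions; measurability of f itself is
   part of Linfty. *)
definition Linfty_norm :: "(real \<Rightarrow> real) \<Rightarrow> ereal" where
  "Linfty_norm f = esssup lebesgue (\<lambda>x. ereal \<bar>f x\<bar>)"

definition Linfty :: "(real \<Rightarrow> real) set" where
  "Linfty = {f. f \<in> borel_measurable lebesgue \<and> Linfty_norm f < \<infinity>}"

definition ae_rel :: "((real \<Rightarrow> real) \<times> (real \<Rightarrow> real)) set" where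
  "ae_rel = {(f, g). f \<in> Linfty \<and> g \<in> Linfty \<and> (AE x in lebesgue. f x = g x)}"

(* The representatives of the classes to which the transform is applied; the classes themselves
   are the elements of the quotient Psi_fun p // ae_rel. *)
definition Psi_fun :: "real \<Rightarrow> (real \<Rightarrow> real) set" where
  "Psi_fun p = {\<Psi>. \<Psi> \<in> Linfty \<and>
     (AE x in lebesgue. \<Psi> (- x) = - \<Psi> x) \<and>
     (AE x in lebesgue. \<Psi> (x + p) = \<Psi> x) \<and>
     Linfty_norm \<Psi> \<le> ereal (1 / 2)}"

definition kernel_integrand :: "(real \<Rightarrow> real) \<Rightarrow> complex \<Rightarrow> real \<Rightarrow> complex" where
  "kernel_integrand \<Psi> w x =
     of_real (\<Psi> x) * sinh (w / 2) / (cosh (of_real x / 2) * cosh ((w - of_real x) / 2))"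

definition S_of :: "(real \<Rightarrow> real) \<Rightarrow> complex \<Rightarrow> complex" where
  "S_of \<Psi> = (\<lambda>w\<in>strip. 1 / 2 * (LINT x|lebesgue. kernel_integrand \<Psi> w x))"

(* The induced map on almost-everywhere classes: the common value of S_of on a class.
   It is meaningful only if S_of is constant on the class. *)
definition S_of_class :: "(real \<Rightarrow> real) set \<Rightarrow> complex \<Rightarrow> complex" where
  "S_of_class C = the_elem (S_of ` C)"

end

theory Submission
  imports Defs "HOL-Complex_Analysis.Complex_Analysis" "HOL-Probability.Probability"
begin

text \<open>The kernel equals \<open>tanh ((w - x) / 2) + tanh (x / 2)\<close>, so that \<open>Im S (u + i v)\<close> is half the convolution of
  \<open>\<Psi>\<close> with the Poisson kernel \<open>sin v / (cosh t + cos v)\<close> of the strip \<open>0 < Im w < \<pi>\<close>, whose total mass is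
  \<open>2 v\<close>: this gives the bound on \<open>Im S\<close>, and by the Lebesgue density theorem it recovers \<open>\<Psi>\<close> almost everywhere
  as a boundary value, hence injectivity.

  For surjectivity, let \<open>0 < r < 1\<close>. The dilation \<open>w \<mapsto> S (r w)\<close> is analytic beyond the closed strip, and as the kernel
  takes the same values on the lines \<open>Im z = \<pi>\<close> and \<open>Im z = - \<pi>\<close> after a shift by \<open>i \<pi>\<close>, the residue theorem represents it
  by the kernel and its own boundary density \<open>\<Psi>\<^sub>r\<close>. Since \<open>\<Psi>\<^sub>r\<close> is odd and bounded by \<open>1/2\<close>, the measures with density
  \<open>1 + 2 \<Psi>\<^sub>r\<close> with respect to the logistic distribution are probability measures; a weak limit as \<open>r \<rightarrow> 1\<close> has a density
  of the same form by the Radon-Nikodym theorem. Oddness and periodicity of the limit are read off its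
  boundary values.\<close>

subsection \<open>The kernel and its transform\<close>

text \<open>No boundary values on the line Im w = pi are available at the start, and the definition
  of \<open>W p\<close> bounds only the imaginary part. Dilation supplies continuity up to the
  boundary and, through periodicity, a bound on the whole modulus, which is needed to discard the
  vertical sides of the contour. The price is that S (r w) has period p / r, so periodicity cannot
  be carried through the limit and is regained afterwards. Evenness does survive, and so does the
  reflection S (cnj w) = cnj (S w), which holds because the bound at Im w = 0 makes S real on the
  real axis. Reflection turns the difference of the values on the two lines into 2 i Im S; together
  with evenness it makes the boundary density odd, which is what gives the measures total mass one.
  The logistic density is the right reference because it decays like the kernel: their quotient is a
  bounded continuous function, hence a test function for weak convergence.\<close>

lemma norm_cosh_squared: "(norm (cosh z))\<^sup>2 = (cos (Im z))\<^sup>2 + (sinh (Re z))\<^sup>2" for z :: complex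
proof -
  have "exp (Re z) * exp (- Re z) = 1" by (simp flip: exp_add)
  then show ?thesis
    using norm_cos_squared[of "\<i> * z"]
    by (simp add: cosh_conv_cos sinh_def exp_minus field_simps power2_eq_square)
qed

text \<open>In the formula for the squared norm, shrinking (sinh x)^2 to (cos y)^2 (sinh x)^2 lets
  (cos y)^2 be factored out. The bound keeps the exponential growth in the real part.\<close>

lemma norm_cosh_ge: "\<bar>cos (Im z)\<bar> * cosh (Re z) \<le> norm (cosh z)" for z :: complex
proof (rule power2_le_imp_le)
  have "(cos (Im z))\<^sup>2 * (sinh (Re z))\<^sup>2 \<le> 1 * (sinh (Re z))\<^sup>2"
    by (intro mult_right_mono) (auto simp: abs_square_le_1)
  moreover have "(cosh (Re z))\<^sup>2 = 1 + (sinh (Re z))\<^sup>2" by (simp add: cosh_square_eq)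
  ultimately show "(\<bar>cos (Im z)\<bar> * cosh (Re z))\<^sup>2 \<le> (norm (cosh z))\<^sup>2"
    by (simp add: power_mult_distrib norm_cosh_squared distrib_left)
qed simp

lemma cosh_add_ge: "cosh x * exp (- \<bar>a\<bar>) \<le> cosh (x + a)" for x a :: real
proof -
  have "exp x * exp (- \<bar>a\<bar>) \<le> exp x * exp a" "exp (- x) * exp (- \<bar>a\<bar>) \<le> exp (- x) * exp (- a)"
    by (intro mult_left_mono; simp)+
  then have "(exp x + exp (- x)) * exp (- \<bar>a\<bar>) \<le> exp (x + a) + exp (- (x + a))"
    by (auto simp add: distrib_right simp flip: exp_add intro!: add_mono)
  then show ?thesis by (simp add: cosh_def)
qed

lemma strip_cos_pos: "w \<in> strip \<Longrightarrow> 0 < cos (Im w / 2)"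
  by (rule cos_gt_zero_pi) (auto simp: strip_def)

text \<open>The growth in x is compared with the fixed function cosh (x / 2), and all dependence on
  w is moved into a factor. Only so can one integrable majorant serve for all w near a given
  point.\<close>

lemma strip_cosh_ge:
  assumes "w \<in> strip"
  shows "cos (Im w / 2) * exp (- \<bar>Re w\<bar> / 2) * cosh (x / 2) \<le> norm (cosh ((w - of_real x) / 2))"
proof -
  have "cosh (- x / 2) * exp (- \<bar>Re w / 2\<bar>) \<le> cosh (- x / 2 + Re w / 2)"
    by (rule cosh_add_ge)
  then have "exp (- \<bar>Re w\<bar> / 2) * cosh (x / 2) \<le> cosh ((Re w - x) / 2)"
    by (simp add: diff_divide_distrib algebra_simps)
  then have "cos (Im w / 2) * (exp (- \<bar>Re w\<bar> / 2) * cosh (x / 2)) \<le> cos (Im w / 2) * cosh ((Re w - x) / 2)"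
    using strip_cos_pos[OF assms] by (intro mult_left_mono) auto
  also have "\<dots> \<le> norm (cosh ((w - of_real x) / 2))"
    using norm_cosh_ge[of "(w - of_real x) / 2"] strip_cos_pos[OF assms] by simp
  finally show ?thesis by (simp add: mult.assoc)
qed

lemma strip_cosh_nonzero: "w \<in> strip \<Longrightarrow> cosh ((w - of_real x) / 2) \<noteq> 0"
  using strip_cosh_ge[of w x] strip_cos_pos[of w]
  by (metis cosh_real_pos exp_gt_zero mult_pos_pos norm_zero not_le)

lemma zero_in_strip [simp]: "0 \<in> strip" and uminus_in_strip: "w \<in> strip \<Longrightarrow> - w \<in> strip"
  and cnj_in_strip: "w \<in> strip \<Longrightarrow> cnj w \<in> strip"
  and add_real_in_strip: "w \<in> strip \<Longrightarrow> w + of_real p \<in> strip"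
  and of_real_in_strip [simp]: "of_real p \<in> strip"
  by (auto simp: strip_def)

lemma convex_strip: "convex strip"
proof -
  have "strip = {w. Im w < pi} \<inter> {w. - pi < Im w}" by (auto simp: strip_def)
  then show ?thesis
    by (metis convex_Int convex_halfspace_Im_lt convex_halfspace_Im_gt)
qed

lemma open_strip: "open strip"
proof -
  have "strip = {w. Im w < pi} \<inter> {w. - pi < Im w}" by (auto simp: strip_def)
  then show ?thesis
    by (metis open_Int open_halfspace_Im_lt open_halfspace_Im_gt)
qed

text \<open>Multiplied by sinh ((w - w') / 2) this is tanh ((w - x) / 2) - tanh ((w' - x) / 2). The
  choice w' = 0 gives the kernel of the transform, w' = cnj w gives the Poisson kernel up to a
  factor.\<close>

definition sech_pair :: "complex \<Rightarrow> complex \<Rightarrow> real \<Rightarrow> complex" where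
  "sech_pair w w' x = 1 / (cosh ((w - of_real x) / 2) * cosh ((w' - of_real x) / 2))"

text \<open>The constant in the comparison of 1 / cosh ((w - x) / 2) with 1 / cosh (x / 2). It is
  continuous on the strip, hence locally bounded there.\<close>

definition sech_bound :: "complex \<Rightarrow> real" where
  "sech_bound w = exp (\<bar>Re w\<bar> / 2) / cos (Im w / 2)"

lemma sech_bound_pos: "w \<in> strip \<Longrightarrow> 0 < sech_bound w"
  by (simp add: sech_bound_def strip_cos_pos)

lemma norm_sech_le:
  assumes "w \<in> strip"
  shows "norm (1 / cosh ((w - of_real x) / 2)) \<le> sech_bound w / cosh (x / 2)"
proof -
  have "0 < cos (Im w / 2) * exp (- \<bar>Re w\<bar> / 2) * cosh (x / 2)"
    using strip_cos_pos[OF assms] by (intro mult_pos_pos) auto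
  then have "inverse (norm (cosh ((w - of_real x) / 2))) \<le> inverse (cos (Im w / 2) * exp (- \<bar>Re w\<bar> / 2) * cosh (x / 2))"
    using strip_cosh_ge[OF assms, of x] by (intro le_imp_inverse_le)
  also have "\<dots> = sech_bound w / cosh (x / 2)"
    by (simp add: sech_bound_def exp_minus field_simps)
  finally show ?thesis by (simp add: norm_divide inverse_eq_divide)
qed

lemma norm_sech_pair_le:
  assumes "w \<in> strip" "w' \<in> strip"
  shows "norm (sech_pair w w' x) \<le> sech_bound w * sech_bound w' / (cosh (x / 2))\<^sup>2"
proof -
  have "norm (sech_pair w w' x) = norm (1 / cosh ((w - of_real x) / 2)) * norm (1 / cosh ((w' - of_real x) / 2))"
    by (simp add: sech_pair_def norm_mult norm_divide)
  also have "\<dots> \<le> (sech_bound w / cosh (x / 2)) * (sech_bound w' / cosh (x / 2))"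
    using assms by (intro mult_mono norm_sech_le) (auto simp: less_imp_le sech_bound_pos)
  finally show ?thesis by (simp add: power2_eq_square)
qed

lemma sech_pair_measurable [measurable]: "sech_pair w w' \<in> borel_measurable borel"
  unfolding sech_pair_def cosh_def by measurable

text \<open>The density of the standard logistic distribution. Up to a constant depending on w and
  w' it dominates every \<open>sech_pair w w'\<close>, so it is both the integrable majorant and,
  later, the reference measure.\<close>

definition logistic :: "real \<Rightarrow> real" where "logistic x = 1 / (4 * (cosh (x / 2))\<^sup>2)"

lemma logistic_pos: "0 < logistic x"
  by (simp add: logistic_def)

lemma logistic_measurable [measurable]: "logistic \<in> borel_measurable borel"
  unfolding logistic_def cosh_def by measurable

lemma has_bochner_integral_logistic: "has_bochner_integral lborel logistic 1"
proof -
  have "has_bochner_integral lborel (\<lambda>x. indicator {0..} x *\<^sub>R logistic x) (1/2)"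
  proof (rule has_bochner_integral_nn_integral)
    have "(\<integral>\<^sup>+x. ennreal (logistic x) * indicator {0..} x \<partial>lborel) = ennreal (1/2 - tanh (0/2) / 2)"
    proof (rule nn_integral_FTC_atLeast)
      fix x :: real
      show "((\<lambda>x. tanh (x/2) / 2) has_real_derivative logistic x) (at x)"
        by (auto intro!: derivative_eq_intros simp: logistic_def tanh_def field_simps power2_eq_square[symmetric])
           (simp add: cosh_square_eq)
    next
      show "((\<lambda>x::real. tanh (x/2) / 2) \<longlongrightarrow> 1/2) at_top"
        by real_asymp
    qed (auto simp: logistic_pos less_imp_le)
    then show "(\<integral>\<^sup>+x. ennreal (indicator {0..} x *\<^sub>R logistic x) \<partial>lborel) = ennreal (1/2)"
      by (subst nn_integral_cong[where v = "\<lambda>x. ennreal (logistic x) * indicator {0..} x"])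
         (auto simp: indicator_def ennreal_divide_numeral split: if_splits)
  qed (auto simp: logistic_pos less_imp_le)
  from has_bochner_integral_even_function[OF this] show ?thesis
    by (simp add: logistic_def[abs_def])
qed

lemma integrable_sech_pair:
  assumes \<Psi>: "\<Psi> \<in> borel_measurable borel" "\<And>x. \<bar>\<Psi> x\<bar> \<le> M" and w: "w \<in> strip" "w' \<in> strip"
  shows "integrable lborel (\<lambda>x. of_real (\<Psi> x) * sech_pair w w' x)"
proof (rule Bochner_Integration.integrable_bound)
  show "integrable lborel (\<lambda>x. 4 * M * (sech_bound w * sech_bound w') * logistic x)"
    using has_bochner_integral_logistic by (auto simp: has_bochner_integral_iff)
  show "AE x in lborel. norm (of_real (\<Psi> x) * sech_pair w w' x) \<le> norm (4 * M * (sech_bound w * sech_bound w') * logistic x)"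
  proof (rule AE_I2)
    fix x
    have "norm (of_real (\<Psi> x) * sech_pair w w' x) \<le> M * (sech_bound w * sech_bound w' / (cosh (x / 2))\<^sup>2)"
      unfolding norm_mult using \<Psi>(2)[of x] norm_sech_pair_le[OF w, of x]
      by (intro mult_mono) auto
    also have "\<dots> = 4 * M * (sech_bound w * sech_bound w') * logistic x"
      by (simp add: logistic_def)
    finally show "norm (of_real (\<Psi> x) * sech_pair w w' x) \<le> norm (4 * M * (sech_bound w * sech_bound w') * logistic x)"
      by simp
  qed
qed (use \<Psi> in measurable)

text \<open>This is \<open>tanh a - tanh b = (tanh a - tanh c) - (tanh b - tanh c)\<close>; it turns differences of the transform
  into a single absolutely convergent integral.\<close>

lemma sech_pair_identity:
  assumes "w \<in> strip" "w' \<in> strip"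
  shows "sinh ((w - w') / 2) * sech_pair w w' x
    = sinh (w / 2) * sech_pair w 0 x - sinh (w' / 2) * sech_pair w' 0 x"
proof -
  define a b c where "a = (w - of_real x) / 2" and "b = (w' - of_real x) / 2" and "c = (0 - complex_of_real x) / 2"
  have nz: "cosh a \<noteq> 0" "cosh b \<noteq> 0" "cosh c \<noteq> 0"
    using assms strip_cosh_nonzero zero_in_strip unfolding a_def b_def c_def by blast+
  have "sinh (a - b) / (cosh a * cosh b) = sinh (a - c) / (cosh a * cosh c) - sinh (b - c) / (cosh b * cosh c)"
    using nz by (simp add: sinh_diff field_simps)
  moreover have "a - b = (w - w') / 2" "a - c = w / 2" "b - c = w' / 2"
    by (simp_all add: a_def b_def c_def diff_divide_distrib)
  ultimately have "sinh ((w - w') / 2) / (cosh a * cosh b) = sinh (w / 2) / (cosh a * cosh c) - sinh (w' / 2) / (cosh b * cosh c)"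
    by metis
  then show ?thesis by (simp add: sech_pair_def a_def b_def c_def)
qed

lemma kernel_integrand_eq: "kernel_integrand \<Psi> w x = sinh (w / 2) * (of_real (\<Psi> x) * sech_pair w 0 x)"
  by (simp add: kernel_integrand_def sech_pair_def mult.commute)

lemma integrable_kernel:
  assumes "\<Psi> \<in> borel_measurable borel" "\<And>x. \<bar>\<Psi> x\<bar> \<le> M" "w \<in> strip"
  shows "integrable lborel (kernel_integrand \<Psi> w)"
  unfolding kernel_integrand_eq[abs_def] using integrable_sech_pair[OF assms zero_in_strip] by simp

text \<open>The transform \<open>S_of\<close> with \<open>lborel\<close> in place of
  \<open>lebesgue\<close> and without restriction to the strip. The analysis is done for bounded
  Borel functions; \<open>S_of_eq_pot\<close> makes the passage back.\<close>

definition pot :: "(real \<Rightarrow> real) \<Rightarrow> complex \<Rightarrow> complex" where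
  "pot \<Psi> w = 1 / 2 * (LINT x|lborel. kernel_integrand \<Psi> w x)"

lemma pot_diff:
  assumes \<Psi>: "\<Psi> \<in> borel_measurable borel" "\<And>x. \<bar>\<Psi> x\<bar> \<le> M" and w: "w \<in> strip" "w' \<in> strip"
  shows "pot \<Psi> w - pot \<Psi> w' = 1 / 2 * sinh ((w - w') / 2) * (LINT x|lborel. of_real (\<Psi> x) * sech_pair w w' x)"
proof -
  have "pot \<Psi> w - pot \<Psi> w' = 1 / 2 * (LINT x|lborel. kernel_integrand \<Psi> w x - kernel_integrand \<Psi> w' x)"
    unfolding pot_def
    by (subst Bochner_Integration.integral_diff) (use integrable_kernel[OF \<Psi>] w in \<open>auto simp: algebra_simps\<close>)
  also have "(\<lambda>x. kernel_integrand \<Psi> w x - kernel_integrand \<Psi> w' x)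
      = (\<lambda>x. sinh ((w - w') / 2) * (of_real (\<Psi> x) * sech_pair w w' x))"
  proof
    fix x
    have "kernel_integrand \<Psi> w x - kernel_integrand \<Psi> w' x
      = of_real (\<Psi> x) * (sinh (w / 2) * sech_pair w 0 x - sinh (w' / 2) * sech_pair w' 0 x)"
      by (simp add: kernel_integrand_eq algebra_simps)
    then show "kernel_integrand \<Psi> w x - kernel_integrand \<Psi> w' x
      = sinh ((w - w') / 2) * (of_real (\<Psi> x) * sech_pair w w' x)"
      by (simp add: sech_pair_identity[OF w, symmetric])
  qed
  finally show ?thesis by simp
qed

lemma isCont_sech_bound: "w \<in> strip \<Longrightarrow> isCont sech_bound w"
  unfolding sech_bound_def[abs_def] using strip_cos_pos[of w] by (intro continuous_intros) auto

lemma tendsto_sech_pair: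
  assumes \<Psi>: "\<Psi> \<in> borel_measurable borel" "\<And>x. \<bar>\<Psi> x\<bar> \<le> M" and w: "w \<in> strip" "w' \<in> strip"
    and f: "f \<longlonglongrightarrow> w"
  shows "(\<lambda>n. LINT x|lborel. of_real (\<Psi> x) * sech_pair (f n) w' x)
    \<longlonglongrightarrow> (LINT x|lborel. of_real (\<Psi> x) * sech_pair w w' x)"
proof -
  have "(\<lambda>n. sech_bound (f n)) \<longlonglongrightarrow> sech_bound w"
    using isCont_tendsto_compose[OF isCont_sech_bound[OF w(1)] f] .
  then have "eventually (\<lambda>n. sech_bound (f n) < sech_bound w + 1) sequentially"
    by (rule order_tendstoD) simp
  moreover have "eventually (\<lambda>n. f n \<in> strip) sequentially"
    using topological_tendstoD[OF f open_strip w(1)] .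
  ultimately have "eventually (\<lambda>n. f n \<in> strip \<and> sech_bound (f n) < sech_bound w + 1) sequentially"
    by eventually_elim simp
  then obtain N where N: "\<And>n. n \<ge> N \<Longrightarrow> f n \<in> strip \<and> sech_bound (f n) < sech_bound w + 1"
    unfolding eventually_sequentially by blast
  \<comment> \<open>The majorant must hold for every index, but only the terms from N on are known
    to lie in the strip and to have a controlled \<open>sech_bound\<close>.\<close>
  let ?g = "\<lambda>n. f (n + N)"
  have g: "?g \<longlonglongrightarrow> w" using LIMSEQ_ignore_initial_segment[OF f] .
  have M: "0 \<le> M" using \<Psi>(2)[of 0] by linarith
  have "(\<lambda>n. LINT x|lborel. of_real (\<Psi> x) * sech_pair (?g n) w' x)
    \<longlonglongrightarrow> (LINT x|lborel. of_real (\<Psi> x) * sech_pair w w' x)"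
  proof (rule integral_dominated_convergence)
    show "integrable lborel (\<lambda>x. 4 * M * ((sech_bound w + 1) * sech_bound w') * logistic x)"
      using has_bochner_integral_logistic by (auto simp: has_bochner_integral_iff)
    show "AE x in lborel. norm (of_real (\<Psi> x) * sech_pair (?g n) w' x)
        \<le> 4 * M * ((sech_bound w + 1) * sech_bound w') * logistic x" for n
    proof (rule AE_I2)
      fix x
      have gs: "?g n \<in> strip" and gb: "sech_bound (?g n) \<le> sech_bound w + 1"
        using N[of "n + N"] by auto
      have "norm (sech_pair (?g n) w' x) \<le> sech_bound (?g n) * sech_bound w' / (cosh (x / 2))\<^sup>2"
        by (rule norm_sech_pair_le[OF gs w(2)])
      also have "\<dots> \<le> (sech_bound w + 1) * sech_bound w' / (cosh (x / 2))\<^sup>2"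
        using gb sech_bound_pos[OF w(2)] by (intro divide_right_mono mult_right_mono) auto
      finally have "norm (of_real (\<Psi> x) * sech_pair (?g n) w' x) \<le> M * ((sech_bound w + 1) * sech_bound w' / (cosh (x / 2))\<^sup>2)"
        unfolding norm_mult using \<Psi>(2)[of x] M by (intro mult_mono) auto
      then show "norm (of_real (\<Psi> x) * sech_pair (?g n) w' x)
        \<le> 4 * M * ((sech_bound w + 1) * sech_bound w') * logistic x"
        by (simp add: logistic_def)
    qed
    show "AE x in lborel. (\<lambda>n. of_real (\<Psi> x) * sech_pair (?g n) w' x) \<longlonglongrightarrow> of_real (\<Psi> x) * sech_pair w w' x"
      unfolding sech_pair_def using g strip_cosh_nonzero w
      by (intro AE_I2 tendsto_intros isCont_tendsto_compose[OF isCont_cosh]) auto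
  qed (use \<Psi> in measurable)
  then show ?thesis by (rule LIMSEQ_offset)
qed

text \<open>By \<open>pot_diff\<close> the difference quotient is an elementary factor tending to 1
  / 2 times an integral that is continuous in w', so no derivative has to be taken under the
  integral sign.\<close>

lemma holomorphic_pot:
  assumes \<Psi>: "\<Psi> \<in> borel_measurable borel" "\<And>x. \<bar>\<Psi> x\<bar> \<le> M"
  shows "pot \<Psi> holomorphic_on strip"
proof (rule holomorphic_onI)
  fix w assume w: "w \<in> strip"
  let ?J = "\<lambda>w'. LINT x|lborel. of_real (\<Psi> x) * sech_pair w' w x"
  have "((\<lambda>w'. (pot \<Psi> w' - pot \<Psi> w) / (w' - w)) \<longlongrightarrow> 1 / 4 * ?J w) (at w)"
  proof (rule tendsto_at_iff_sequentially[THEN iffD2], intro allI impI)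
    fix f :: "nat \<Rightarrow> complex" assume f: "\<forall>i. f i \<in> UNIV - {w}" "f \<longlonglongrightarrow> w"
    have "((\<lambda>z. (sinh ((z - w) / 2)) / (z - w)) \<longlongrightarrow> 1 / 2) (at w)"
    proof -
      have "((\<lambda>z. sinh ((z - w) / 2)) has_field_derivative 1 / 2) (at w)"
        by (auto intro!: derivative_eq_intros)
      then show ?thesis by (simp add: has_field_derivative_iff)
    qed
    then have s: "(\<lambda>n. sinh ((f n - w) / 2) / (f n - w)) \<longlonglongrightarrow> 1 / 2"
      using f by (auto simp: tendsto_at_iff_sequentially comp_def)
    have "(\<lambda>n. 1 / 2 * (sinh ((f n - w) / 2) / (f n - w)) * ?J (f n)) \<longlonglongrightarrow> 1 / 2 * (1 / 2) * ?J w"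
      by (intro tendsto_mult tendsto_const s tendsto_sech_pair[OF \<Psi> w w f(2)])
    moreover have "eventually (\<lambda>n. 1 / 2 * (sinh ((f n - w) / 2) / (f n - w)) * ?J (f n)
        = (pot \<Psi> (f n) - pot \<Psi> w) / (f n - w)) sequentially"
      using topological_tendstoD[OF f(2) open_strip w]
      by eventually_elim (simp add: pot_diff[OF \<Psi> _ w])
    ultimately show "((\<lambda>w'. (pot \<Psi> w' - pot \<Psi> w) / (w' - w)) \<circ> f) \<longlonglongrightarrow> 1 / 4 * ?J w"
      by (simp add: comp_def Lim_transform_eventually)
  qed
  then have "(pot \<Psi> has_field_derivative 1 / 4 * ?J w) (at w)"
    by (simp add: has_field_derivative_iff)
  then show "pot \<Psi> field_differentiable at w within strip"
    using field_differentiable_at_within field_differentiable_def by blast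
qed

lemma pot_cnj: "pot \<Psi> (cnj w) = cnj (pot \<Psi> w)"
proof -
  have "kernel_integrand \<Psi> (cnj w) x = cnj (kernel_integrand \<Psi> w x)" for x
    by (simp add: kernel_integrand_def cosh_def sinh_def exp_cnj)
  then have "kernel_integrand \<Psi> (cnj w) = (\<lambda>x. cnj (kernel_integrand \<Psi> w x))" by (rule ext)
  then show ?thesis unfolding pot_def by simp
qed

section \<open>The imaginary part of the transform as a Poisson integral\<close>

definition poisson :: "real \<Rightarrow> real \<Rightarrow> real" where
  "poisson v t = sin v / (cosh t + cos v)"

lemma sech_pair_cnj:
  "sech_pair w (cnj w) x = of_real (2 / (cosh (Re w - x) + cos (Im w)))"
proof -
  have "cosh ((cnj w - of_real x) / 2) = cnj (cosh ((w - of_real x) / 2))"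
    by (simp add: cosh_def exp_cnj)
  then have "sech_pair w (cnj w) x = of_real (1 / (norm (cosh ((w - of_real x) / 2)))\<^sup>2)"
    by (simp add: sech_pair_def flip: of_real_power complex_norm_square)
  also have "(norm (cosh ((w - of_real x) / 2)))\<^sup>2 = (cosh (Re w - x) + cos (Im w)) / 2"
  proof -
    have "cosh (Re w - x) = 2 * (cosh ((Re w - x) / 2))\<^sup>2 - 1"
      using cosh_double_cosh[of "(Re w - x) / 2"] by (simp only: mult_2 field_sum_of_halves)
    moreover have "cos (Im w) = 2 * (cos (Im w / 2))\<^sup>2 - 1"
      using cos_double_cos[of "Im w / 2"] by simp
    ultimately show ?thesis by (simp add: norm_cosh_squared cosh_square_eq)
  qed
  finally show ?thesis by (simp only: divide_divide_eq_right mult_1_left)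
qed

text \<open>Since 2 i Im (pot w) = pot w - pot (cnj w), the difference formula applies with w' = cnj
  w. There sinh ((w - w') / 2) = i sin (Im w), and the remaining kernel is real.\<close>

lemma Im_pot:
  assumes \<Psi>: "\<Psi> \<in> borel_measurable borel" "\<And>x. \<bar>\<Psi> x\<bar> \<le> M" and w: "w \<in> strip"
  shows "integrable lborel (\<lambda>x. \<Psi> x * poisson (Im w) (Re w - x))"
    and "Im (pot \<Psi> w) = 1 / 2 * (LINT x|lborel. \<Psi> x * poisson (Im w) (Re w - x))"
proof -
  let ?k = "\<lambda>x. \<Psi> x * (2 / (cosh (Re w - x) + cos (Im w)))"
  have e: "of_real (\<Psi> x) * sech_pair w (cnj w) x = complex_of_real (?k x)" for x
    by (simp add: sech_pair_cnj)
  have i: "integrable lborel ?k"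
    using integrable_sech_pair[OF \<Psi> w cnj_in_strip[OF w]] unfolding e by (rule complex_of_real_integrable_eq[THEN iffD1])
  have p: "\<Psi> x * poisson (Im w) (Re w - x) = sin (Im w) / 2 * ?k x" for x
    by (simp add: poisson_def)
  show "integrable lborel (\<lambda>x. \<Psi> x * poisson (Im w) (Re w - x))"
    unfolding p by (intro integrable_mult_right i)
  have sh: "sinh ((w - cnj w) / 2) = \<i> * of_real (sin (Im w))"
  proof -
    have "\<i> * ((w - cnj w) / 2) = - of_real (Im w)"
      by (simp add: complex_diff_cnj algebra_simps)
    then show ?thesis by (simp only: sinh_conv_sin sin_minus sin_of_real) simp
  qed
  have "2 * \<i> * of_real (Im (pot \<Psi> w)) = pot \<Psi> w - pot \<Psi> (cnj w)"
    by (simp add: pot_cnj complex_diff_cnj)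
  also have "\<dots> = 1 / 2 * (\<i> * of_real (sin (Im w))) * of_real (LINT x|lborel. ?k x)"
    unfolding pot_diff[OF \<Psi> w cnj_in_strip[OF w]] e sh by (subst integral_complex_of_real) (rule refl)
  finally have "Im (2 * \<i> * of_real (Im (pot \<Psi> w))) = Im (1 / 2 * (\<i> * of_real (sin (Im w))) * of_real (LINT x|lborel. ?k x))"
    by (rule arg_cong)
  then have "Im (pot \<Psi> w) = 1 / 4 * sin (Im w) * (LINT x|lborel. ?k x)" by simp
  then show "Im (pot \<Psi> w) = 1 / 2 * (LINT x|lborel. \<Psi> x * poisson (Im w) (Re w - x))"
    unfolding p integral_mult_right_zero by simp
qed

subsection \<open>Density points\<close>

text \<open>A Vitali argument. Enclose B = ball 0 R - A in an open U with U - B of measure below (c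
  / 2) e, and cover the bad points, up to a null set, by disjoint intervals inside U of radius r,
  each carrying more than c r of A. These portions of A are disjoint and lie in U - B, so the
  intervals, of length 2 r, have total length at most (2 / c) (c / 2) e = e.\<close>

lemma negligible_positive_density_points:
  fixes A :: "real set"
  assumes A: "A \<in> sets lebesgue" and c: "0 < c"
  shows "negligible {x \<in> ball 0 R - A. \<forall>d>0. \<exists>r. 0 < r \<and> r < d \<and> c * r < measure lebesgue (A \<inter> cball x r)}"
    (is "negligible ?E")
  unfolding negligible_outer_le
proof (intro allI impI)
  fix e :: real assume e: "0 < e"
  let ?B = "ball 0 R - A"
  have B: "?B \<in> sets lebesgue" using A by auto
  obtain U where U: "open U" "?B \<subseteq> U" "U - ?B \<in> lmeasurable" "emeasure lebesgue (U - ?B) < ennreal (c / 2 * e)"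
    by (rule sets_lebesgue_outer_open[OF B, of "c / 2 * e"]) (use e c in auto)
  have mU: "measure lebesgue (U - ?B) \<le> c / 2 * e"
    unfolding measure_def by (rule enn2real_leI) (use U(4) c e in auto)
  define K where "K = {(x, r). x \<in> ?E \<and> 0 < r \<and> cball x r \<subseteq> U \<inter> ball 0 R \<and> c * r < measure lebesgue (A \<inter> cball x r)}"
  have K: "0 < snd i" "cball (fst i) (snd i) \<subseteq> U" "c * snd i < measure lebesgue (A \<inter> cball (fst i) (snd i))" if "i \<in> K" for i
    using that unfolding K_def by (cases i, simp)+
  obtain C where C: "countable C" "C \<subseteq> K"
     "pairwise (\<lambda>i j. disjnt (cball (fst i) (snd i)) (cball (fst j) (snd j))) C"
     "negligible (?E - (\<Union>i \<in> C. cball (fst i) (snd i)))"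
  proof (rule Vitali_covering_theorem_cballs[of K snd ?E fst])
    show "0 < snd i" if "i \<in> K" for i using that by (rule K)
  next
    fix x d :: real assume x: "x \<in> ?E" and d: "0 < d"
    have "open (U \<inter> ball 0 R)" "x \<in> U \<inter> ball 0 R" using U x by auto
    then obtain k where k: "0 < k" "cball x k \<subseteq> U \<inter> ball 0 R"
      by (meson open_contains_cball)
    have "0 < min d k" using d k by simp
    then obtain r where r: "0 < r" "r < min d k" "c * r < measure lebesgue (A \<inter> cball x r)"
      using x by blast
    have "cball x r \<subseteq> cball x k" using r by (intro subset_cball) auto
    with k r x show "\<exists>i. i \<in> K \<and> x \<in> cball (fst i) (snd i) \<and> snd i < d"
      by (intro exI[of _ "(x, r)"]) (auto simp: K_def)
  qed (rule that)
  let ?V = "\<Union>i \<in> C. cball (fst i) (snd i)"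
  \<comment> \<open>A bound for all finite subfamilies passes to the countable union, so only finite
    additivity is needed here.\<close>
  have fin: "measure lebesgue (\<Union>i\<in>F. cball (fst i) (snd i)) \<le> e" if F: "F \<subseteq> C" "finite F" for F
  proof -
    have mA: "A \<inter> cball a r \<in> lmeasurable" for a r
      using fmeasurable_Int_fmeasurable[of "cball a r" lebesgue A] A by (simp add: Int_commute)
    have "measure lebesgue (\<Union>i\<in>F. cball (fst i) (snd i)) \<le> (\<Sum>i\<in>F. measure lebesgue (cball (fst i) (snd i)))"
      using F by (intro measure_UNION_le) auto
    also have "\<dots> \<le> (\<Sum>i\<in>F. 2 / c * measure lebesgue (A \<inter> cball (fst i) (snd i)))"
    proof (rule sum_mono)
      fix i assume "i \<in> F"
      then have i: "0 < snd i" "c * snd i < measure lebesgue (A \<inter> cball (fst i) (snd i))"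
        using F C(2) K by blast+
      have "measure lebesgue (cball (fst i) (snd i)) = 2 * snd i"
        using i by (simp add: cball_eq_atLeastAtMost)
      then show "measure lebesgue (cball (fst i) (snd i)) \<le> 2 / c * measure lebesgue (A \<inter> cball (fst i) (snd i))"
        using i c by (simp add: field_simps)
    qed
    also have "\<dots> = 2 / c * measure lebesgue (\<Union>i\<in>F. A \<inter> cball (fst i) (snd i))"
    proof -
      have "disjoint_family_on (\<lambda>i. A \<inter> cball (fst i) (snd i)) F"
        using pairwise_subset[OF C(3) F(1)] unfolding disjoint_family_on_def pairwise_def disjnt_def
        by blast
      moreover have "A \<inter> cball a r \<in> sets lebesgue" "emeasure lebesgue (A \<inter> cball a r) \<noteq> \<infinity>" for a r
        using mA[of a r] by (auto simp: fmeasurable_def)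
      ultimately show ?thesis
        using F by (subst measure_finite_Union) (auto simp: sum_distrib_left)
    qed
    also have "\<dots> \<le> 2 / c * measure lebesgue (U - ?B)"
    proof (intro mult_left_mono measure_mono_fmeasurable)
      show "(\<Union>i\<in>F. A \<inter> cball (fst i) (snd i)) \<subseteq> U - ?B"
      proof
        fix y assume "y \<in> (\<Union>i\<in>F. A \<inter> cball (fst i) (snd i))"
        then obtain i where i: "i \<in> F" "y \<in> A" "y \<in> cball (fst i) (snd i)" by blast
        then have "cball (fst i) (snd i) \<subseteq> U" using F C(2) K by blast
        with i show "y \<in> U - ?B" by blast
      qed
      show "(\<Union>i\<in>F. A \<inter> cball (fst i) (snd i)) \<in> sets lebesgue"
        using F(2) mA by (intro sets.finite_UN) (auto simp: fmeasurable_def)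
    qed (use U(3) c in auto)
    also have "\<dots> \<le> 2 / c * (c / 2 * e)"
      using mU c by (intro mult_left_mono) auto
    finally show ?thesis using c by simp
  qed
  have V: "?V \<in> lmeasurable" "measure lebesgue ?V \<le> e"
    using fmeasurable_UN_bound[OF C(1) _ fin] measure_UN_bound[OF C(1) _ fin] by auto
  have "?V \<union> (?E - ?V) \<in> lmeasurable" "measure lebesgue (?V \<union> (?E - ?V)) = measure lebesgue ?V"
    using fmeasurable.Un[OF V(1) negligible_imp_measurable[OF C(4)]]
      measure_Un_null_set[OF fmeasurableD[OF V(1)] C(4)[unfolded negligible_iff_null_sets]] by blast+
  then show "\<exists>T. ?E \<subseteq> T \<and> T \<in> lmeasurable \<and> measure lebesgue T \<le> e"
    using V by (intro exI[of _ "?V \<union> (?E - ?V)"] conjI) (blast, assumption, simp only:)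
qed

definition zero_density :: "real set \<Rightarrow> real \<Rightarrow> bool" where
  "zero_density A x \<longleftrightarrow> (\<forall>c>0. \<exists>d>0. \<forall>r. 0 < r \<and> r < d \<longrightarrow> measure lborel (A \<inter> cball x r) \<le> c * r)"

text \<open>The exceptional points grow as c decreases and as R increases, so c = 1 / (n + 1) and
  natural numbers R capture all of them in a countable union.\<close>

lemma AE_zero_density:
  fixes A :: "real set"
  assumes A: "A \<in> sets borel"
  shows "AE x in lborel. x \<notin> A \<longrightarrow> zero_density A x"
proof -
  let ?E = "\<lambda>c R. {x \<in> ball 0 R - A. \<forall>d>0. \<exists>r. 0 < r \<and> r < d \<and> c * r < measure lebesgue (A \<inter> cball x r)}"
  have "negligible (\<Union>n. \<Union>m. ?E (1 / real (Suc n)) (real m))"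
    by (intro negligible_Union_nat negligible_positive_density_points) (use A in auto)
  then have "(\<Union>n. \<Union>m. ?E (1 / real (Suc n)) (real m)) \<in> null_sets lebesgue"
    by (simp add: negligible_iff_null_sets)
  then have "AE x in lebesgue. x \<notin> A \<longrightarrow> zero_density A x"
  proof (rule AE_I')
    show "{x \<in> space lebesgue. \<not> (x \<notin> A \<longrightarrow> zero_density A x)} \<subseteq> (\<Union>n. \<Union>m. ?E (1 / real (Suc n)) (real m))"
    proof
      fix x assume "x \<in> {x \<in> space lebesgue. \<not> (x \<notin> A \<longrightarrow> zero_density A x)}"
      then obtain c where x: "x \<notin> A" and c: "0 < c" "\<forall>d>0. \<exists>r. 0 < r \<and> r < d \<and> c * r < measure lborel (A \<inter> cball x r)"
        by (auto simp: zero_density_def not_le)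
      obtain n where n: "1 / real (Suc n) < c" using c(1) reals_Archimedean by (auto simp: inverse_eq_divide)
      obtain m where m: "\<bar>x\<bar> < real m" using reals_Archimedean2 by blast
      have "x \<in> ?E (1 / real (Suc n)) (real m)"
      proof (safe intro!: CollectI)
        fix d :: real assume "0 < d"
        then obtain r where r: "0 < r" "r < d" "c * r < measure lborel (A \<inter> cball x r)" using c by blast
        have "1 / real (Suc n) * r < c * r" using n r by (intro mult_strict_right_mono) auto
        with r show "\<exists>r. 0 < r \<and> r < d \<and> 1 / real (Suc n) * r < measure lebesgue (A \<inter> cball x r)"
          using A by (intro exI[of _ r]) (auto simp: measure_completion)
      qed (use x m in \<open>auto simp: dist_norm\<close>)
      then show "x \<in> (\<Union>n. \<Union>m. ?E (1 / real (Suc n)) (real m))" by blast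
    qed
  qed
  then show ?thesis by (simp add: AE_completion_iff)
qed

subsection \<open>Boundary values of the Poisson integral\<close>

lemma poisson_denom_pos:
  assumes "0 < v" "v < pi" shows "0 < cosh t + cos v"
proof -
  have "-1 < cos v" using cos_monotone_0_pi[of v pi] assms by simp
  then show ?thesis using cosh_real_ge_1[of t] by linarith
qed

lemma poisson_nonneg: "0 < v \<Longrightarrow> v < pi \<Longrightarrow> 0 \<le> poisson v t"
  using poisson_denom_pos[of v t] unfolding poisson_def by (intro divide_nonneg_pos sin_ge_zero) auto

lemma poisson_measurable [measurable]: "poisson v \<in> borel_measurable borel"
proof -
  have "poisson v = (\<lambda>t. sin v / ((exp t + exp (- t)) / 2 + cos v))"
    by (auto simp: poisson_def cosh_def)
  then show ?thesis by simp
qed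

lemma has_bochner_integral_poisson:
  assumes v: "0 < v" "v < pi"
  shows "has_bochner_integral lborel (poisson v) (2 * v)"
proof -
  let ?k = "tan (v / 2)"
  have c: "cos (v / 2) > 0" using v by (intro cos_gt_zero_pi) auto
  \<comment> \<open>With u = tanh (t / 2) and k = tan (v / 2) the kernel becomes 2 k / (1 + k^2 u^2)
    du, whence the antiderivative. At infinity it tends to 2 arctan k = v, which is half of the
    total mass.\<close>
  have D: "((\<lambda>t. 2 * arctan (?k * tanh (t / 2))) has_real_derivative poisson v t) (at t)" for t
  proof -
    have "1 + (?k * tanh (t / 2))\<^sup>2 > 0" by (simp add: add_pos_nonneg)
    have ch: "cosh t = (cosh (t / 2))\<^sup>2 + (sinh (t / 2))\<^sup>2"
      using cosh_double[of "t / 2"] by simp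
    have cv: "cos v = (cos (v / 2))\<^sup>2 - (sin (v / 2))\<^sup>2" "sin v = 2 * sin (v / 2) * cos (v / 2)"
      using cos_double[of "v / 2"] sin_double[of "v / 2"] by simp_all
    have den: "cosh t + cos v = 2 * ((cos (v / 2))\<^sup>2 * (cosh (t / 2))\<^sup>2 + (sin (v / 2))\<^sup>2 * (sinh (t / 2))\<^sup>2)"
    proof -
      have s: "(sin (v / 2))\<^sup>2 = 1 - (cos (v / 2))\<^sup>2" by (simp add: sin_squared_eq)
      show ?thesis unfolding ch cv(1) s cosh_square_eq by (simp add: algebra_simps)
    qed
    have pos: "0 < (cos (v / 2))\<^sup>2 * (cosh (t / 2))\<^sup>2 + (sin (v / 2))\<^sup>2 * (sinh (t / 2))\<^sup>2"
      using c by (intro add_pos_nonneg mult_pos_pos) auto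
    have "2 * (?k * ((1 - (tanh (t / 2))\<^sup>2) * (1 / 2)) / (1 + (?k * tanh (t / 2))\<^sup>2)) = poisson v t"
    proof -
      have 1: "1 - (tanh (t / 2))\<^sup>2 = 1 / (cosh (t / 2))\<^sup>2"
        by (simp add: tanh_def power_divide field_simps) (simp add: cosh_square_eq)
      have 2: "1 + (?k * tanh (t / 2))\<^sup>2 =
         ((cos (v / 2))\<^sup>2 * (cosh (t / 2))\<^sup>2 + (sin (v / 2))\<^sup>2 * (sinh (t / 2))\<^sup>2) / ((cos (v / 2))\<^sup>2 * (cosh (t / 2))\<^sup>2)"
        using c by (simp add: tanh_def tan_def power_divide power_mult_distrib divide_simps)
      show ?thesis unfolding 1 2 poisson_def den cv(2)
        using c pos by (simp add: tan_def divide_simps power2_eq_square)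
    qed
    then show ?thesis
      by (auto intro!: derivative_eq_intros simp: power2_eq_square field_simps inverse_eq_divide)
  qed
  have "has_bochner_integral lborel (\<lambda>x. indicator {0..} x *\<^sub>R poisson v x) v"
  proof (rule has_bochner_integral_nn_integral)
    have "(\<integral>\<^sup>+x. ennreal (poisson v x) * indicator {0..} x \<partial>lborel) = ennreal (v - 2 * arctan (?k * tanh (0/2)))"
    proof (rule nn_integral_FTC_atLeast)
      have "((\<lambda>t. 2 * arctan (?k * tanh (t / 2))) \<longlongrightarrow> 2 * arctan (?k * 1)) at_top"
      proof (intro tendsto_intros)
        show "((\<lambda>t::real. tanh (t / 2)) \<longlongrightarrow> 1) at_top" by real_asymp
      qed
      then show "((\<lambda>t. 2 * arctan (?k * tanh (t / 2))) \<longlongrightarrow> v) at_top"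
        using v by (simp add: arctan_tan)
    qed (use D poisson_nonneg v in auto)
    then show "(\<integral>\<^sup>+x. ennreal (indicator {0..} x *\<^sub>R poisson v x) \<partial>lborel) = ennreal v"
      by (subst nn_integral_cong[where v = "\<lambda>x. ennreal (poisson v x) * indicator {0..} x"])
         (auto simp: indicator_def split: if_splits)
  qed (use v poisson_nonneg in \<open>auto simp: indicator_def\<close>)
  from has_bochner_integral_even_function[OF this] show ?thesis
    by (simp add: poisson_def[abs_def])
qed

text \<open>Minus the derivative of the Poisson kernel; its positivity for positive arguments writes the
  Poisson kernel as a positive superposition of indicator functions of centred intervals.\<close>

definition poisson_slope :: "real \<Rightarrow> real \<Rightarrow> real" where
  "poisson_slope v s = sin v * sinh s / (cosh s + cos v)\<^sup>2"

lemma poisson_slope_measurable [measurable]: "poisson_slope v \<in> borel_measurable borel"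
proof -
  have "poisson_slope v = (\<lambda>s. sin v * ((exp s - exp (- s)) / 2) / ((exp s + exp (- s)) / 2 + cos v)\<^sup>2)"
    by (auto simp: poisson_slope_def cosh_def sinh_def)
  then show ?thesis by simp
qed

lemma poisson_slope_nonneg: "0 < v \<Longrightarrow> v < pi \<Longrightarrow> 0 \<le> s \<Longrightarrow> 0 \<le> poisson_slope v s"
  unfolding poisson_slope_def by (intro divide_nonneg_nonneg mult_nonneg_nonneg sin_ge_zero) auto

lemma poisson_layers:
  assumes v: "0 < v" "v < pi"
  shows "ennreal (poisson v t) = (\<integral>\<^sup>+s. ennreal (poisson_slope v s) * indicator {\<bar>t\<bar>..} s \<partial>lborel)"
proof -
  have "(\<integral>\<^sup>+s. ennreal (poisson_slope v s) * indicator {\<bar>t\<bar>..} s \<partial>lborel) = ennreal (0 - (- poisson v \<bar>t\<bar>))"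
  proof (rule nn_integral_FTC_atLeast)
    fix x
    show "((\<lambda>x. - poisson v x) has_real_derivative poisson_slope v x) (at x)"
      unfolding poisson_def poisson_slope_def using poisson_denom_pos[OF v, of x]
      by (auto intro!: derivative_eq_intros simp: power2_eq_square)
    show "\<bar>t\<bar> \<le> x \<Longrightarrow> 0 \<le> poisson_slope v x" using v by (intro poisson_slope_nonneg) auto
  next
    show "((\<lambda>x. - poisson v x) \<longlongrightarrow> 0) at_top"
      unfolding poisson_def by real_asymp
  qed auto
  also have "poisson v \<bar>t\<bar> = poisson v t" by (simp add: poisson_def abs_if)
  finally show ?thesis by simp
qed

text \<open>Tonelli applied to the layers: for fixed s the points y of A with |x - y| at most s form
  \<open>A \<inter> cball x s\<close>. This ties the Poisson integral of an indicator at x to the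
  density of A at x.\<close>

lemma nn_integral_poisson_layers:
  assumes v: "0 < v" "v < pi" and A [measurable]: "A \<in> sets borel"
  shows "(\<integral>\<^sup>+y. ennreal (poisson v (x - y)) * indicator A y \<partial>lborel)
    = (\<integral>\<^sup>+s. ennreal (poisson_slope v s) * emeasure lborel (A \<inter> cball x s) \<partial>lborel)"
proof -
  let ?g = "\<lambda>s y. ennreal (poisson_slope v s) * (if \<bar>x - y\<bar> \<le> s \<and> y \<in> A then 1 else 0)"
  have "(\<integral>\<^sup>+y. ennreal (poisson v (x - y)) * indicator A y \<partial>lborel)
     = (\<integral>\<^sup>+y. (\<integral>\<^sup>+s. ?g s y \<partial>lborel) \<partial>lborel)"
    unfolding poisson_layers[OF v]
    by (intro nn_integral_cong, subst nn_integral_multc[symmetric]) (auto simp: indicator_def intro!: nn_integral_cong)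
  also have "\<dots> = (\<integral>\<^sup>+s. (\<integral>\<^sup>+y. ?g s y \<partial>lborel) \<partial>lborel)"
    by (rule lborel_pair.Fubini') measurable
  also have "\<dots> = (\<integral>\<^sup>+s. ennreal (poisson_slope v s) * emeasure lborel (A \<inter> cball x s) \<partial>lborel)"
  proof (rule nn_integral_cong)
    fix s
    have "(\<integral>\<^sup>+y. ?g s y \<partial>lborel)
      = (\<integral>\<^sup>+y. ennreal (poisson_slope v s) * indicator (A \<inter> cball x s) y \<partial>lborel)"
      by (intro nn_integral_cong) (auto simp: indicator_def dist_real_def)
    then show "(\<integral>\<^sup>+y. ?g s y \<partial>lborel)
      = ennreal (poisson_slope v s) * emeasure lborel (A \<inter> cball x s)"
      by (simp add: nn_integral_cmult_indicator)
  qed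
  finally show ?thesis .
qed

text \<open>The layer formula for the whole line. It is used for the running v, to sum the small
  density near x, and for v = pi / 2, to see that the tail majorant has finite total weight.\<close>

lemma nn_integral_poisson_slope:
  assumes v: "0 < v" "v < pi"
  shows "(\<integral>\<^sup>+s. ennreal (poisson_slope v s) * emeasure lborel (cball (x::real) s) \<partial>lborel) = ennreal (2 * v)"
proof -
  have "(\<integral>\<^sup>+s. ennreal (poisson_slope v s) * emeasure lborel (cball x s) \<partial>lborel)
     = (\<integral>\<^sup>+y. ennreal (poisson v (x - y)) \<partial>lborel)"
    using nn_integral_poisson_layers[OF v, of UNIV x] by simp
  also have "\<dots> = (\<integral>\<^sup>+y. ennreal (poisson v y) \<partial>lborel)"
    using nn_integral_real_affine[of "\<lambda>y. ennreal (poisson v y)" "-1" x] by simp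
  also have "\<dots> = ennreal (2 * v)"
    using has_bochner_integral_poisson[OF v] poisson_nonneg[OF v]
    by (auto simp: has_bochner_integral_iff nn_integral_eq_integral)
  finally show ?thesis .
qed

text \<open>For s at least d the denominator stays away from zero uniformly in v: cosh s + cos v is
  at least cosh s - 1, hence at least cosh s (1 - 1 / cosh d). What is left is sinh s / (cosh s)^2,
  the slope at v = pi / 2, times sin v, and sin v tends to 0 as v tends to pi.\<close>

lemma poisson_slope_tail:
  assumes v: "0 < v" "v < pi" and s: "0 < d" "d \<le> s"
  shows "poisson_slope v s \<le> sin v * (cosh d / (cosh d - 1))\<^sup>2 * poisson_slope (pi / 2) s"
proof -
  have d1: "1 < cosh d" using cosh_real_strict_mono s by (metis cosh_0 cosh_real_nonneg_less_iff order.refl less_imp_le)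
  have ds: "cosh d \<le> cosh s" using s by (subst cosh_real_nonneg_le_iff) auto
  have s1: "1 < cosh s" using d1 ds by simp
  have "0 < cosh s * ((cosh d - 1) / cosh d)" using d1 s1 by simp
  moreover have "cosh s * ((cosh d - 1) / cosh d) \<le> cosh s + cos v"
  proof -
    have "cosh s * ((cosh d - 1) / cosh d) = cosh s - cosh s / cosh d" using d1 by (simp add: field_simps)
    also have "\<dots> \<le> cosh s - 1" using ds d1 by simp
    also have "\<dots> \<le> cosh s + cos v" using cos_ge_minus_one[of v] by linarith
    finally show ?thesis .
  qed
  ultimately have le: "(cosh s * ((cosh d - 1) / cosh d))\<^sup>2 \<le> (cosh s + cos v)\<^sup>2"
      and pos: "0 < (cosh s * ((cosh d - 1) / cosh d))\<^sup>2" by (auto intro!: power_mono)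
  have "poisson_slope v s \<le> sin v * sinh s / (cosh s * ((cosh d - 1) / cosh d))\<^sup>2"
    unfolding poisson_slope_def
    using le pos s v by (intro divide_left_mono mult_nonneg_nonneg mult_pos_pos) (auto simp: sin_ge_zero)
  also have "\<dots> = sin v * (cosh d / (cosh d - 1))\<^sup>2 * poisson_slope (pi / 2) s"
    using d1 s1 by (simp add: poisson_slope_def field_simps power2_eq_square)
  finally show ?thesis .
qed

text \<open>Radii below d contribute little because A fills only a small proportion of each interval
  there; radii above d contribute little because the slope itself carries the factor sin v.\<close>

lemma poisson_zero_density:
  assumes A [measurable]: "A \<in> sets borel" and x: "zero_density A x"
  shows "((\<lambda>v. LINT y|lborel. indicator A y * poisson v (x - y)) \<longlongrightarrow> 0) (at_left pi)"
proof (rule tendstoI)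
  fix e :: real assume e: "0 < e"
  \<comment> \<open>The near part is at most c v, so in the limit the bound is c pi = e / 2.\<close>
  define c where "c = e / (2 * pi)"
  have c: "0 < c" using e by (simp add: c_def)
  obtain d where d: "0 < d" "\<And>r. 0 < r \<Longrightarrow> r < d \<Longrightarrow> measure lborel (A \<inter> cball x r) \<le> c * r"
    using x c unfolding zero_density_def by blast
  let ?K = "(cosh d / (cosh d - 1))\<^sup>2"
  have bound: "norm (LINT y|lborel. indicator A y * poisson v (x - y)) \<le> c / 2 * (2 * v) + sin v * ?K * pi"
    if v: "0 < v" "v < pi" for v
  proof -
    have sv: "0 \<le> sin v" using v by (simp add: sin_ge_zero)
    have meas: "emeasure lborel (A \<inter> cball x s) \<le> emeasure lborel (cball x s)" for s
      by (intro emeasure_mono) auto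
    have fin: "emeasure lborel (A \<inter> cball x s) < \<infinity>" for s
      using meas[of s] emeasure_lborel_cball_finite[of x s] by (rule le_less_trans)
    have "(\<integral>\<^sup>+y. ennreal (poisson v (x - y)) * indicator A y \<partial>lborel)
      = (\<integral>\<^sup>+s. ennreal (poisson_slope v s) * emeasure lborel (A \<inter> cball x s) \<partial>lborel)"
      by (rule nn_integral_poisson_layers[OF v A])
    also have "\<dots> \<le> (\<integral>\<^sup>+s. ennreal (c / 2) * (ennreal (poisson_slope v s) * emeasure lborel (cball x s))
         + ennreal (sin v * ?K) * (ennreal (poisson_slope (pi/2) s) * emeasure lborel (cball x s)) \<partial>lborel)"
    \<comment> \<open>The density estimate speaks of positive radii only; the single point s = 0 is
      discarded as a null set.\<close>
    proof (rule nn_integral_mono_AE, rule AE_mp[OF AE_lborel_singleton[of 0]], rule AE_I2, rule impI)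
      fix s :: real
      assume "s \<noteq> 0"
      then consider "s < 0" | "0 < s" "s < d" | "d \<le> s" by linarith
      then show "ennreal (poisson_slope v s) * emeasure lborel (A \<inter> cball x s)
         \<le> ennreal (c / 2) * (ennreal (poisson_slope v s) * emeasure lborel (cball x s))
         + ennreal (sin v * ?K) * (ennreal (poisson_slope (pi/2) s) * emeasure lborel (cball x s))"
      proof cases
        case 1 then show ?thesis by simp
      next
        case 2
        have "emeasure lborel (A \<inter> cball x s) = ennreal (measure lborel (A \<inter> cball x s))"
          using fin[of s] by (intro emeasure_eq_ennreal_measure) auto
        also have "\<dots> \<le> ennreal (c * s)" using d(2) 2 by (intro ennreal_leI) auto
        also have "\<dots> = ennreal (c / 2) * emeasure lborel (cball x s)"
          using 2 c by (simp add: cball_eq_atLeastAtMost flip: ennreal_mult)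
        finally have "ennreal (poisson_slope v s) * emeasure lborel (A \<inter> cball x s)
          \<le> ennreal (poisson_slope v s) * (ennreal (c / 2) * emeasure lborel (cball x s))"
          by (rule mult_left_mono) simp
        also have "\<dots> = ennreal (c / 2) * (ennreal (poisson_slope v s) * emeasure lborel (cball x s))"
          by (rule mult.left_commute)
        finally show ?thesis by (rule add_increasing2[rotated]) simp
      next
        case 3
        have "ennreal (poisson_slope v s) * emeasure lborel (A \<inter> cball x s)
          \<le> ennreal (sin v * ?K * poisson_slope (pi / 2) s) * emeasure lborel (cball x s)"
          using meas[of s] poisson_slope_tail[OF v d(1) 3] by (intro mult_mono ennreal_leI) auto
        also have "\<dots> = ennreal (sin v * ?K) * (ennreal (poisson_slope (pi/2) s) * emeasure lborel (cball x s))"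
          using sv 3 d poisson_slope_nonneg[of "pi/2" s] by (subst ennreal_mult) (auto simp: mult.assoc)
        finally show ?thesis by (rule add_increasing[rotated]) simp
      qed
    qed
    also have "\<dots> = ennreal (c / 2) * ennreal (2 * v) + ennreal (sin v * ?K) * ennreal (2 * (pi / 2))"
    proof -
      have "(\<lambda>s. emeasure lborel (cball x s)) \<in> borel_measurable borel"
        by (subst measurable_cong[where g = "\<lambda>s. ennreal (max 0 (2 * s))"])
           (auto simp: cball_eq_atLeastAtMost max_def ennreal_neg)
      note [measurable] = this
      show ?thesis
        using nn_integral_poisson_slope[OF v, of x] nn_integral_poisson_slope[of "pi/2" x]
        by (subst nn_integral_add) (auto simp: nn_integral_cmult)
    qed
    also have "\<dots> = ennreal (c / 2 * (2 * v) + sin v * ?K * pi)"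
      using c v sv by (simp add: ennreal_plus flip: ennreal_mult)
    finally have nn: "(\<integral>\<^sup>+y. ennreal (norm (indicator A y * poisson v (x - y))) \<partial>lborel)
       \<le> ennreal (c / 2 * (2 * v) + sin v * ?K * pi)"
      using poisson_nonneg[OF v]
      by (subst nn_integral_cong[where v = "\<lambda>y. ennreal (poisson v (x - y)) * indicator A y"])
         (auto simp: indicator_def)
    then have i: "integrable lborel (\<lambda>y. indicator A y * poisson v (x - y))"
      by (intro integrableI_bounded) (auto intro: le_less_trans)
    have "ennreal (norm (LINT y|lborel. indicator A y * poisson v (x - y)))
        \<le> (\<integral>\<^sup>+y. ennreal (norm (indicator A y * poisson v (x - y))) \<partial>lborel)"
      by (rule integral_norm_bound_ennreal[OF i])
    with nn have "ennreal (norm (LINT y|lborel. indicator A y * poisson v (x - y))) \<le> ennreal (c / 2 * (2 * v) + sin v * ?K * pi)"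
      by (rule order_trans[rotated])
    then show ?thesis using c v sv by (subst (asm) ennreal_le_iff) auto
  qed
  have "((\<lambda>v. c / 2 * (2 * v) + sin v * ?K * pi) \<longlongrightarrow> c / 2 * (2 * pi) + sin pi * ?K * pi) (at_left pi)"
    by (intro tendsto_intros)
  moreover have "c / 2 * (2 * pi) + sin pi * ?K * pi < e" using e by (simp add: c_def)
  ultimately have "eventually (\<lambda>v. c / 2 * (2 * v) + sin v * ?K * pi < e) (at_left pi)"
    by (rule order_tendstoD)
  moreover have "eventually (\<lambda>v::real. 0 < v \<and> v < pi) (at_left pi)"
    by (subst eventually_at_left[of 0]) (auto intro!: exI[of _ 0])
  ultimately show "eventually (\<lambda>v. dist (LINT y|lborel. indicator A y * poisson v (x - y)) 0 < e) (at_left pi)"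
    by eventually_elim (use bound in fastforce)
qed

text \<open>Only densities of sets are needed, not Lebesgue points of \<Psi>. For a rational
  \<gamma> slightly above \<Psi> x, the point x lies outside A = {\<Psi> \<ge> \<gamma>} and A has
  density zero at x. The bound \<Psi> \<le> \<gamma> + (M + |\<gamma>|) 1_A then gives a Poisson
  integral whose limit is 2 pi \<gamma>. Rationality of \<gamma> keeps the exceptional set a
  countable union of null sets.\<close>

lemma poisson_limsup:
  assumes \<Psi> [measurable]: "\<Psi> \<in> borel_measurable borel" and M: "\<And>x. \<bar>\<Psi> x\<bar> \<le> M"
  shows "AE x in lborel. \<forall>e>0. eventually (\<lambda>v. (LINT y|lborel. \<Psi> y * poisson v (x - y)) < 2 * pi * \<Psi> x + e) (at_left pi)"
proof -
  have "AE x in lborel. \<forall>\<gamma>\<in>\<rat>. x \<notin> {y. \<gamma> \<le> \<Psi> y} \<longrightarrow> zero_density {y. \<gamma> \<le> \<Psi> y} x"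
    by (intro AE_ball_countable'[OF _ countable_rat] AE_zero_density) measurable
  then show ?thesis
  proof eventually_elim
    case (elim x)
    show ?case
    proof (intro allI impI)
      fix e :: real assume e: "0 < e"
      obtain \<gamma> where \<gamma>: "\<gamma> \<in> \<rat>" "\<Psi> x < \<gamma>" "\<gamma> < \<Psi> x + e / (2 * pi)"
        using Rats_dense_in_real[of "\<Psi> x" "\<Psi> x + e / (2 * pi)"] e by auto
      let ?A = "{y. \<gamma> \<le> \<Psi> y}"
      have z: "zero_density ?A x" using elim \<gamma> by auto
      have [measurable]: "?A \<in> sets borel" by measurable
      let ?I = "\<lambda>v. LINT y|lborel. indicator ?A y * poisson v (x - y)"
      have "((\<lambda>v. \<gamma> * (2 * v) + (M + \<bar>\<gamma>\<bar>) * ?I v) \<longlongrightarrow> \<gamma> * (2 * pi) + (M + \<bar>\<gamma>\<bar>) * 0) (at_left pi)"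
        by (intro tendsto_intros poisson_zero_density z) measurable
      moreover have "\<gamma> * (2 * pi) + (M + \<bar>\<gamma>\<bar>) * 0 < 2 * pi * \<Psi> x + e"
        using \<gamma>(3) by (simp add: field_simps)
      ultimately have "eventually (\<lambda>v. \<gamma> * (2 * v) + (M + \<bar>\<gamma>\<bar>) * ?I v < 2 * pi * \<Psi> x + e) (at_left pi)"
        by (rule order_tendstoD)
      moreover have "eventually (\<lambda>v::real. 0 < v \<and> v < pi) (at_left pi)"
        by (subst eventually_at_left[of 0]) (auto intro!: exI[of _ 0])
      ultimately show "eventually (\<lambda>v. (LINT y|lborel. \<Psi> y * poisson v (x - y)) < 2 * pi * \<Psi> x + e) (at_left pi)"
      proof eventually_elim
        case (elim v)
        have P: "has_bochner_integral lborel (\<lambda>y. poisson v (x - y)) (2 * v)"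
          using lborel_has_bochner_integral_real_affine_iff[of "-1" "poisson v" "2 * v" x]
            has_bochner_integral_poisson elim by simp
        then have Pi: "integrable lborel (\<lambda>y. poisson v (x - y))" "(LINT y|lborel. poisson v (x - y)) = 2 * v"
          by (auto simp: has_bochner_integral_iff)
        have Ai: "integrable lborel (\<lambda>y. indicator ?A y * poisson v (x - y))"
          by (rule Bochner_Integration.integrable_bound[OF Pi(1)]) (auto simp: indicator_def)
        have \<Psi>i: "integrable lborel (\<lambda>y. \<Psi> y * poisson v (x - y))"
        proof (rule Bochner_Integration.integrable_bound)
          show "integrable lborel (\<lambda>y. M * poisson v (x - y))" using Pi by simp
          show "AE y in lborel. norm (\<Psi> y * poisson v (x - y)) \<le> norm (M * poisson v (x - y))"
            using M by (auto simp: abs_mult intro!: mult_right_mono order_trans[OF M])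
        qed auto
        have "(LINT y|lborel. \<Psi> y * poisson v (x - y))
           \<le> (LINT y|lborel. \<gamma> * poisson v (x - y) + (M + \<bar>\<gamma>\<bar>) * (indicator ?A y * poisson v (x - y)))"
        proof (rule integral_mono[OF \<Psi>i])
          fix y
          have "\<Psi> y \<le> \<gamma> + (M + \<bar>\<gamma>\<bar>) * indicator ?A y"
            using M[of y] by (auto simp: indicator_def)
          then have "\<Psi> y * poisson v (x - y) \<le> (\<gamma> + (M + \<bar>\<gamma>\<bar>) * indicator ?A y) * poisson v (x - y)"
            using poisson_nonneg elim by (intro mult_right_mono) auto
          then show "\<Psi> y * poisson v (x - y) \<le> \<gamma> * poisson v (x - y) + (M + \<bar>\<gamma>\<bar>) * (indicator ?A y * poisson v (x - y))"
            by (simp add: algebra_simps)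
        qed (use Pi Ai in simp)
        also have "\<dots> = \<gamma> * (2 * v) + (M + \<bar>\<gamma>\<bar>) * ?I v"
          using Pi Ai by simp
        finally show ?case using elim by simp
      qed
    qed
  qed
qed

text \<open>The one-sided bound for \<Psi> and for -\<Psi> gives the limit 2 pi \<Psi> x of the
  Poisson integral; the factor 1 / 2 from \<open>pot\<close> and the factor 1 / pi reduce it to
  \<Psi> x.\<close>

lemma AE_tendsto_Im_pot:
  assumes \<Psi> [measurable]: "\<Psi> \<in> borel_measurable borel" and M: "\<And>x. \<bar>\<Psi> x\<bar> \<le> M"
  shows "AE x in lborel. ((\<lambda>v. 1 / pi * Im (pot \<Psi> (of_real x + \<i> * of_real v))) \<longlongrightarrow> \<Psi> x) (at_left pi)"
proof -
  have "AE x in lborel. \<forall>e>0. eventually (\<lambda>v. (LINT y|lborel. - \<Psi> y * poisson v (x - y)) < 2 * pi * - \<Psi> x + e) (at_left pi)"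
    by (rule poisson_limsup[where M = M]) (use M in auto)
  with poisson_limsup[OF \<Psi> M] show ?thesis
  proof eventually_elim
    case (elim x)
    let ?I = "\<lambda>v. LINT y|lborel. \<Psi> y * poisson v (x - y)"
    have "(?I \<longlongrightarrow> 2 * pi * \<Psi> x) (at_left pi)"
    proof (rule order_tendstoI)
      fix a assume "a < 2 * pi * \<Psi> x"
      then show "eventually (\<lambda>v. a < ?I v) (at_left pi)"
        using elim(2)[rule_format, of "2 * pi * \<Psi> x - a"] by simp
    next
      fix a assume "2 * pi * \<Psi> x < a"
      then show "eventually (\<lambda>v. ?I v < a) (at_left pi)"
        using elim(1)[rule_format, of "a - 2 * pi * \<Psi> x"] by simp
    qed
    then have "((\<lambda>v. 1 / pi * (1 / 2 * ?I v)) \<longlongrightarrow> 1 / pi * (1 / 2 * (2 * pi * \<Psi> x))) (at_left pi)"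
      by (intro tendsto_intros)
    moreover have "eventually (\<lambda>v. 1 / pi * (1 / 2 * ?I v) = 1 / pi * Im (pot \<Psi> (of_real x + \<i> * of_real v))) (at_left pi)"
    proof -
      have "eventually (\<lambda>v::real. 0 < v \<and> v < pi) (at_left pi)"
        by (subst eventually_at_left[of 0]) (auto intro!: exI[of _ 0])
      then show ?thesis
      proof eventually_elim
        case (elim v)
        then have "of_real x + \<i> * of_real v \<in> strip" by (simp add: strip_def)
        from Im_pot(2)[OF \<Psi> M this] show ?case by (simp add: field_simps)
      qed
    qed
    ultimately have "((\<lambda>v. 1 / pi * Im (pot \<Psi> (of_real x + \<i> * of_real v))) \<longlongrightarrow> 1 / pi * (1 / 2 * (2 * pi * \<Psi> x))) (at_left pi)"
      by (rule Lim_transform_eventually)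
    then show ?case by simp
  qed
qed

subsection \<open>The Cauchy formula in a strip\<close>

lemma sinh_ii_of_real: "sinh (\<i> * of_real y) = \<i> * of_real (sin y)"
  and cosh_ii_of_real: "cosh (\<i> * of_real y) = of_real (cos y)"
proof -
  have "exp (\<i> * of_real y) = cis y" "exp (- (\<i> * of_real y)) = cis (- y)"
    by (simp_all add: cis_conv_exp)
  then show "sinh (\<i> * of_real y) = \<i> * of_real (sin y)" "cosh (\<i> * of_real y) = of_real (cos y)"
    by (simp_all add: sinh_def cosh_def complex_eq_iff)
qed

lemma sinh_add_half_pi: "sinh (u + \<i> * of_real (pi / 2)) = \<i> * cosh u"
  and sinh_diff_half_pi: "sinh (u - \<i> * of_real (pi / 2)) = - \<i> * cosh u" for u :: complex
  unfolding sinh_add sinh_diff sinh_ii_of_real cosh_ii_of_real by simp_all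

lemma norm_sinh_ge: "\<bar>sinh (Re z)\<bar> \<le> norm (sinh z)" for z :: complex
proof (rule power2_le_imp_le)
  have "sinh z = \<i> * cosh (z - \<i> * of_real (pi / 2))"
    unfolding sinh_add_half_pi[symmetric] by simp
  then have "norm (sinh z) = norm (cosh (z - \<i> * of_real (pi / 2)))"
    by (simp add: norm_mult)
  then have "(norm (sinh z))\<^sup>2 = (cos (Im z - pi / 2))\<^sup>2 + (sinh (Re z))\<^sup>2"
    by (simp add: norm_cosh_squared)
  then show "\<bar>sinh (Re z)\<bar>\<^sup>2 \<le> (norm (sinh z))\<^sup>2" by simp
qed simp

lemma sinh_eq_0_imp:
  assumes "sinh z = 0" "\<bar>Im z\<bar> < pi" shows "z = (0::complex)"
proof -
  have r: "Re z = 0" using norm_sinh_ge[of z] assms by simp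
  then have "z = \<i> * of_real (Im z)" by (simp add: complex_eq_iff)
  then have "sinh z = \<i> * of_real (sin (Im z))"
    using sinh_ii_of_real by metis
  then have "sin (Im z) = 0" using assms by simp
  then have "Im z = 0" using assms(2) sin_zero_pi_iff by blast
  with r show ?thesis by (simp add: complex_eq_iff)
qed

section \<open>Contour integrals over horizontal lines and rectangles\<close>

lemma contour_integral_linepath_horizontal:
  assumes "continuous_on {z. Im z = y} f" "a < b"
  shows "contour_integral (linepath (of_real a + \<i> * of_real y) (of_real b + \<i> * of_real y)) f
    = integral {a..b} (\<lambda>x. f (of_real x + \<i> * of_real y))"
proof -
  have "contour_integral (linepath (of_real a + \<i> * of_real y) (of_real b + \<i> * of_real y)) f
    = contour_integral (linepath (of_real a) (of_real b)) (\<lambda>z. f (z + \<i> * of_real y))"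
    unfolding contour_integral_integral
    by (simp add: linepath_def scaleR_conv_of_real algebra_simps)
  also have "\<dots> = integral {a..b} (\<lambda>x. f (of_real x + \<i> * of_real y))"
    using assms(2) by (subst contour_integral_linepath_Reals_eq) auto
  finally show ?thesis .
qed

lemma contour_integral_rectpath:
  assumes f: "continuous_on (path_image (rectpath (Complex a c) (Complex b d))) f" and "a < b" "c < d"
  shows "contour_integral (rectpath (Complex a c) (Complex b d)) f
    = contour_integral (linepath (Complex a c) (Complex b c)) f
      + contour_integral (linepath (Complex b c) (Complex b d)) f
      - contour_integral (linepath (Complex a d) (Complex b d)) f
      - contour_integral (linepath (Complex a c) (Complex a d)) f"
proof -
  have pi: "path_image (rectpath (Complex a c) (Complex b d)) =
      closed_segment (Complex a c) (Complex b c) \<union> closed_segment (Complex b c) (Complex b d)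
      \<union> closed_segment (Complex b d) (Complex a d) \<union> closed_segment (Complex a d) (Complex a c)"
    by (simp add: rectpath_def Let_def path_image_join Un_assoc)
  have "f contour_integrable_on linepath (Complex a c) (Complex b c)"
    "f contour_integrable_on linepath (Complex b c) (Complex b d)"
    "f contour_integrable_on linepath (Complex b d) (Complex a d)"
    "f contour_integrable_on linepath (Complex a d) (Complex a c)"
    using f unfolding pi by (auto intro!: contour_integrable_continuous_linepath elim: continuous_on_subset)
  then have "contour_integral (rectpath (Complex a c) (Complex b d)) f
    = contour_integral (linepath (Complex a c) (Complex b c)) f
      + (contour_integral (linepath (Complex b c) (Complex b d)) f
      + (contour_integral (linepath (Complex b d) (Complex a d)) f
      + contour_integral (linepath (Complex a d) (Complex a c)) f))"
    by (simp add: rectpath_def Let_def contour_integrable_joinI)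
  moreover have "contour_integral (linepath (Complex b d) (Complex a d)) f = - contour_integral (linepath (Complex a d) (Complex b d)) f"
    "contour_integral (linepath (Complex a d) (Complex a c)) f = - contour_integral (linepath (Complex a c) (Complex a d)) f"
    using f unfolding pi
    by (auto intro!: contour_integral_reverse_linepath elim: continuous_on_subset simp: closed_segment_commute)
  ultimately show ?thesis by simp
qed

context
  fixes T :: "complex \<Rightarrow> complex" and \<eta> B :: real and w :: complex
  assumes \<eta>: "0 < \<eta>" and T: "T holomorphic_on {z. \<bar>Im z\<bar> < pi + \<eta>}"
    and B: "\<And>z. \<bar>Im z\<bar> \<le> pi \<Longrightarrow> norm (T z) \<le> B"
    and T0: "T 0 = 0" and w: "w \<in> strip" "w \<noteq> 0"
begin

text \<open>On the two lines \<open>Im z = \<pi>\<close> and \<open>Im z = - \<pi>\<close> the denominator of \<open>f\<close> becomes that of \<open>sech_pair w 0\<close>, while its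
  pole at \<open>0\<close> is removable because \<open>T\<close> vanishes there.\<close>

private definition f where "f z = T z / (sinh ((w - z) / 2) * sinh (z / 2))"
text \<open>The margin \<delta> is small enough that T is holomorphic on the enlarged strip
  \<open>s\<close>, and that |Im ((w - z) / 2)| and |Im (z / 2)| stay below pi for z in
  \<open>s\<close>. Then the only zeros of the two sinh factors in \<open>s\<close> are w and
  0.\<close>

private definition \<delta> where "\<delta> = min \<eta> (pi - \<bar>Im w\<bar>)"
private definition s where "s = {z. \<bar>Im z\<bar> < pi + \<delta>}"

private lemma \<delta>: "0 < \<delta>" "\<delta> \<le> \<eta>" "\<bar>Im w\<bar> + pi + \<delta> \<le> 2 * pi" "\<delta> \<le> pi"
  using \<eta> w unfolding \<delta>_def strip_def by auto

private lemma s_eq: "s = {z. Im z < pi + \<delta>} \<inter> {z. - (pi + \<delta>) < Im z}"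
  by (auto simp: s_def)

private lemma open_s: "open s" and connected_s: "connected s"
  unfolding s_eq
  by (intro open_Int open_halfspace_Im_lt open_halfspace_Im_gt,
      intro convex_connected convex_Int convex_halfspace_Im_lt convex_halfspace_Im_gt)

private lemma in_s: "0 \<in> s" "w \<in> s"
  using \<delta> w pi_gt_zero by (auto simp: s_def strip_def abs_if)

private lemma holo_T: "T holomorphic_on s"
  by (rule holomorphic_on_subset[OF T]) (use \<delta> in \<open>auto simp: s_def\<close>)

private lemma sinh_nz1: "z \<in> s \<Longrightarrow> z \<noteq> 0 \<Longrightarrow> sinh (z / 2) \<noteq> 0"
  using sinh_eq_0_imp[of "z / 2"] \<delta> by (auto simp: s_def)

private lemma sinh_nz2: "z \<in> s \<Longrightarrow> z \<noteq> w \<Longrightarrow> sinh ((w - z) / 2) \<noteq> 0"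
proof -
  assume "z \<in> s" "z \<noteq> w"
  then have "\<bar>Im ((w - z) / 2)\<bar> < pi" using \<delta>(3) by (simp add: s_def)
  with \<open>z \<noteq> w\<close> show ?thesis using sinh_eq_0_imp[of "(w - z) / 2"] by auto
qed

private lemma holo_f: "f holomorphic_on s - {0, w}"
  unfolding f_def using sinh_nz1 sinh_nz2
  by (intro holomorphic_intros holomorphic_on_subset[OF holo_T]) (auto simp: sinh_def intro!: holomorphic_intros)

text \<open>The factor -2 is the reciprocal of -1 / 2, the derivative of sinh ((w - z) / 2) with
  respect to z at z = w.\<close>

private lemma residue_w: "residue f w = - 2 * T w / sinh (w / 2)"
proof (rule residue_simple'[where s = "s - {0}"])
  show "open (s - {0})" using open_s by (simp add: open_delete)
  show "w \<in> s - {0}" using in_s w by simp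
  show "f holomorphic_on s - {0} - {w}" using holo_f by (simp add: Diff_insert2[symmetric] insert_commute)
  have "((\<lambda>z. sinh ((w - z) / 2)) has_field_derivative - (1 / 2)) (at w)"
    by (auto intro!: derivative_eq_intros)
  then have "((\<lambda>z. sinh ((w - z) / 2) / (z - w)) \<longlongrightarrow> - (1 / 2)) (at w)"
    by (simp add: has_field_derivative_iff)
  then have 1: "((\<lambda>z. inverse (sinh ((w - z) / 2) / (z - w))) \<longlongrightarrow> inverse (- (1 / 2))) (at w)"
    by (rule tendsto_inverse) simp
  have "isCont T w" using holo_T open_s in_s
    by (meson continuous_on_eq_continuous_at holomorphic_on_imp_continuous_on)
  then have "((\<lambda>z. T z / sinh (z / 2) * inverse (sinh ((w - z) / 2) / (z - w))) \<longlongrightarrow> T w / sinh (w / 2) * inverse (- (1 / 2))) (at w)"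
    using sinh_nz1[OF in_s(2) w(2)] by (intro tendsto_mult 1 tendsto_intros) (auto simp: isCont_def)
  then show "((\<lambda>z. f z * (z - w)) \<longlongrightarrow> - 2 * T w / sinh (w / 2)) (at w)"
    by (simp add: f_def field_simps)
qed

private lemma residue_0: "residue f 0 = 0"
proof (rule residue_simple'[where s = "s - {w}"])
  show "open (s - {w})" using open_s by (simp add: open_delete)
  show "0 \<in> s - {w}" using in_s w by simp
  show "f holomorphic_on s - {w} - {0}" using holo_f by (simp add: Diff_insert2[symmetric] insert_commute)
  have "((\<lambda>z::complex. sinh (z / 2)) has_field_derivative 1 / 2) (at 0)"
    by (auto intro!: derivative_eq_intros)
  then have "((\<lambda>z::complex. sinh (z / 2) / z) \<longlongrightarrow> 1 / 2) (at 0)"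
    by (simp add: has_field_derivative_iff)
  then have 1: "((\<lambda>z::complex. inverse (sinh (z / 2) / z)) \<longlongrightarrow> inverse (1 / 2)) (at 0)"
    by (rule tendsto_inverse) simp
  have "isCont T 0" using holo_T open_s in_s
    by (meson continuous_on_eq_continuous_at holomorphic_on_imp_continuous_on)
  then have "((\<lambda>z. T z / sinh ((w - z) / 2) * inverse (sinh (z / 2) / z)) \<longlongrightarrow> T 0 / sinh ((w - 0) / 2) * inverse (1 / 2)) (at 0)"
    using sinh_nz2[OF in_s(1)] w by (intro tendsto_mult 1 tendsto_intros) (auto simp: isCont_def)
  then show "((\<lambda>z. f z * (z - 0)) \<longlongrightarrow> 0) (at 0)"
    by (simp add: f_def field_simps T0)
qed

private lemma contour_f:
  assumes R: "\<bar>Re w\<bar> < R"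
  shows "path_image (rectpath (Complex (-R) (-pi)) (Complex R pi)) \<subseteq> s - {0, w}"
    and "contour_integral (rectpath (Complex (-R) (-pi)) (Complex R pi)) f = - 4 * pi * \<i> * T w / sinh (w / 2)"
proof -
  let ?g = "rectpath (Complex (-R) (-pi)) (Complex R pi)"
  have R0: "0 < R" using R by linarith
  have box: "0 \<in> box (Complex (-R) (-pi)) (Complex R pi)" "w \<in> box (Complex (-R) (-pi)) (Complex R pi)"
    using R R0 w by (auto simp: in_box_complex_iff strip_def abs_if split: if_splits)
  show img: "path_image ?g \<subseteq> s - {0, w}"
  proof
    fix z assume z: "z \<in> path_image ?g"
    then have "z \<in> cbox (Complex (-R) (-pi)) (Complex R pi)" "z \<notin> box (Complex (-R) (-pi)) (Complex R pi)"
      using R0 by (auto simp: path_image_rectpath_cbox_minus_box)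
    then show "z \<in> s - {0, w}"
      using box \<delta> by (auto simp: s_def in_cbox_complex_iff abs_if)
  qed
  have "contour_integral ?g f = 2 * pi * \<i> * (\<Sum>p\<in>{0, w}. winding_number ?g p * residue f p)"
  proof (rule Residue_theorem[OF open_s connected_s _ holo_f _ _ img])
    show "\<forall>z. z \<notin> s \<longrightarrow> winding_number ?g z = 0"
    proof (intro allI impI winding_number_rectpath_outside)
      fix z assume "z \<notin> s"
      then show "z \<notin> cbox (Complex (-R) (-pi)) (Complex R pi)"
        using \<delta> by (auto simp: s_def in_cbox_complex_iff)
    qed (use R0 in auto)
  qed auto
  also have "\<dots> = - 4 * pi * \<i> * T w / sinh (w / 2)"
    using w(2) box by (simp add: winding_number_rectpath residue_0 residue_w)
  finally show "contour_integral ?g f = - 4 * pi * \<i> * T w / sinh (w / 2)" .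
qed

text \<open>On Re z = r with |r| = R the distance of the real parts of w and z is at least R - |Re
  w|. Both sinh factors therefore grow exponentially with R, while T is bounded and the side has the
  fixed length 2 pi.\<close>

private lemma vertical_bound:
  assumes R: "\<bar>Re w\<bar> < R" and r: "\<bar>r\<bar> = R"
  shows "norm (contour_integral (linepath (Complex r (-pi)) (Complex r pi)) f)
    \<le> B / (sinh ((R - \<bar>Re w\<bar>) / 2) * sinh (R / 2)) * (2 * pi)"
proof -
  have R0: "0 < R" using R by linarith
  have B0: "0 \<le> B" by (rule order_trans[OF norm_ge_zero B[of 0]]) simp
  have seg: "Re z = r \<and> \<bar>Im z\<bar> \<le> pi" if "z \<in> closed_segment (Complex r (-pi)) (Complex r pi)" for z
    using that by (subst (asm) closed_segment_same_Re) (auto simp: closed_segment_eq_real_ivl)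
  have pos: "0 < sinh ((R - \<bar>Re w\<bar>) / 2)" "0 < sinh (R / 2)" using R R0 by auto
  have "norm (contour_integral (linepath (Complex r (-pi)) (Complex r pi)) f)
    \<le> B / (sinh ((R - \<bar>Re w\<bar>) / 2) * sinh (R / 2)) * norm (Complex r pi - Complex r (-pi))"
  proof (rule contour_integral_bound_linepath)
    show "f contour_integrable_on linepath (Complex r (-pi)) (Complex r pi)"
    proof (rule contour_integrable_continuous_linepath, rule continuous_on_subset[OF holomorphic_on_imp_continuous_on[OF holo_f]])
      show "closed_segment (Complex r (-pi)) (Complex r pi) \<subseteq> s - {0, w}"
        using seg \<delta> R R0 r by (force simp: s_def)
    qed
  next
    fix z assume "z \<in> closed_segment (Complex r (-pi)) (Complex r pi)"
    then have z: "Re z = r" "\<bar>Im z\<bar> \<le> pi" using seg by auto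
    have "sinh ((R - \<bar>Re w\<bar>) / 2) \<le> sinh \<bar>Re ((w - z) / 2)\<bar>"
      using z r abs_triangle_ineq2[of "Re z" "Re w"] by (subst sinh_real_le_iff) (auto simp: abs_minus_commute)
    also have "\<dots> \<le> norm (sinh ((w - z) / 2))"
      using norm_sinh_ge[of "(w - z) / 2"] by (simp only: sinh_real_abs)
    finally have 1: "sinh ((R - \<bar>Re w\<bar>) / 2) \<le> norm (sinh ((w - z) / 2))" .
    have "sinh (R / 2) = \<bar>sinh (Re (z / 2))\<bar>"
      using z r R0 by (auto simp: abs_if)
    also have "\<dots> \<le> norm (sinh (z / 2))" by (rule norm_sinh_ge)
    finally have 2: "sinh (R / 2) \<le> norm (sinh (z / 2))" .
    have "norm (f z) = norm (T z) / (norm (sinh ((w - z) / 2)) * norm (sinh (z / 2)))"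
      by (simp add: f_def norm_divide norm_mult)
    also have "\<dots> \<le> B / (sinh ((R - \<bar>Re w\<bar>) / 2) * sinh (R / 2))"
      using 1 2 pos B[OF z(2)] B0 by (intro frac_le mult_mono mult_pos_pos) auto
    finally show "norm (f z) \<le> B / (sinh ((R - \<bar>Re w\<bar>) / 2) * sinh (R / 2))" .
  qed (use B0 pos in auto)
  also have "norm (Complex r pi - Complex r (-pi)) = 2 * pi"
    by (simp add: cmod_eq_Im)
  finally show ?thesis .
qed

private lemma f_boundary:
  "f (of_real x + \<i> * of_real pi) = T (of_real x + \<i> * of_real pi) * sech_pair w 0 x"
  "f (of_real x - \<i> * of_real pi) = T (of_real x - \<i> * of_real pi) * sech_pair w 0 x"
proof -
  have "(w - (of_real x + \<i> * of_real pi)) / 2 = (w - of_real x) / 2 - \<i> * of_real (pi / 2)"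
    "(of_real x + \<i> * of_real pi) / 2 = of_real x / 2 + \<i> * of_real (pi / 2)"
    "(w - (of_real x - \<i> * of_real pi)) / 2 = (w - of_real x) / 2 + \<i> * of_real (pi / 2)"
    "(of_real x - \<i> * of_real pi) / 2 = of_real x / 2 - \<i> * of_real (pi / 2)"
    by (simp_all add: diff_divide_distrib add_divide_distrib)
  moreover have "(- \<i> * a) * (\<i> * b) = a * b" "(\<i> * a) * (- \<i> * b) = a * b" for a b :: complex
    by (simp_all add: complex_eq_iff)
  ultimately have e: "sinh ((w - (of_real x + \<i> * of_real pi)) / 2) * sinh ((of_real x + \<i> * of_real pi) / 2)
      = cosh ((w - of_real x) / 2) * cosh (of_real x / 2)"
    "sinh ((w - (of_real x - \<i> * of_real pi)) / 2) * sinh ((of_real x - \<i> * of_real pi) / 2)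
      = cosh ((w - of_real x) / 2) * cosh (of_real x / 2)"
    by (simp_all only: sinh_add_half_pi sinh_diff_half_pi)
  show "f (of_real x + \<i> * of_real pi) = T (of_real x + \<i> * of_real pi) * sech_pair w 0 x"
    unfolding f_def e by (simp add: sech_pair_def)
  show "f (of_real x - \<i> * of_real pi) = T (of_real x - \<i> * of_real pi) * sech_pair w 0 x"
    unfolding f_def e by (simp add: sech_pair_def)
qed

text \<open>The contour runs along the lower line from left to right and along the upper line from
  right to left. The integral of upper minus lower values is therefore minus the contour integral,
  up to vertical sides that vanish in the limit, and the sign of the residue is reversed.\<close>

lemma cauchy_strip_limit:
  "(\<lambda>n. integral {- real n..real n}
      (\<lambda>x. (T (of_real x + \<i> * of_real pi) - T (of_real x - \<i> * of_real pi)) * sech_pair w 0 x))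
    \<longlonglongrightarrow> 4 * pi * \<i> * T w / sinh (w / 2)"
proof -
  let ?g = "\<lambda>x. (T (of_real x + \<i> * of_real pi) - T (of_real x - \<i> * of_real pi)) * sech_pair w 0 x"
  let ?c = "4 * pi * \<i> * T w / sinh (w / 2)"
  let ?b = "\<lambda>n. B / (sinh ((real n - \<bar>Re w\<bar>) / 2) * sinh (real n / 2)) * (2 * pi)"
  have cont: "continuous_on {z. Im z = y} f" if "y = pi \<or> y = - pi" for y
    by (rule continuous_on_subset[OF holomorphic_on_imp_continuous_on[OF holo_f]])
       (use that w \<delta> in \<open>auto simp: s_def strip_def\<close>)
  have "norm (integral {- real n..real n} ?g - ?c) \<le> 2 * ?b n" if n: "\<bar>Re w\<bar> < real n" for n
  proof -
    let ?R = "real n"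
    have R0: "0 < ?R" using n by linarith
    have h1: "contour_integral (linepath (Complex (-?R) (-pi)) (Complex ?R (-pi))) f
        = integral {-?R..?R} (\<lambda>x. f (of_real x - \<i> * of_real pi))"
      using contour_integral_linepath_horizontal[OF cont[of "- pi"], of "-?R" ?R] R0 by (simp add: Complex_eq)
    have h2: "contour_integral (linepath (Complex (-?R) pi) (Complex ?R pi)) f
        = integral {-?R..?R} (\<lambda>x. f (of_real x + \<i> * of_real pi))"
      using contour_integral_linepath_horizontal[OF cont[of pi], of "-?R" ?R] R0 by (simp add: Complex_eq)
    have i: "(\<lambda>x. f (of_real x - \<i> * of_real pi)) integrable_on {-?R..?R}"
      "(\<lambda>x. f (of_real x + \<i> * of_real pi)) integrable_on {-?R..?R}"
      by (intro integrable_continuous_real continuous_on_compose2[OF cont[of "- pi"]] continuous_on_compose2[OF cont[of pi]] continuous_intros; auto)+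
    have "integral {-?R..?R} ?g = integral {-?R..?R} (\<lambda>x. f (of_real x + \<i> * of_real pi) - f (of_real x - \<i> * of_real pi))"
      by (simp add: f_boundary left_diff_distrib)
    also have "\<dots> = integral {-?R..?R} (\<lambda>x. f (of_real x + \<i> * of_real pi)) - integral {-?R..?R} (\<lambda>x. f (of_real x - \<i> * of_real pi))"
      using i by (simp add: integral_diff)
    finally have "integral {-?R..?R} ?g - ?c
      = integral {-?R..?R} (\<lambda>x. f (of_real x + \<i> * of_real pi)) - integral {-?R..?R} (\<lambda>x. f (of_real x - \<i> * of_real pi)) + (- ?c)"
      by (simp only: diff_conv_add_uminus)
    moreover have "- ?c = integral {-?R..?R} (\<lambda>x. f (of_real x - \<i> * of_real pi))
      + contour_integral (linepath (Complex ?R (-pi)) (Complex ?R pi)) f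
      - integral {-?R..?R} (\<lambda>x. f (of_real x + \<i> * of_real pi))
      - contour_integral (linepath (Complex (-?R) (-pi)) (Complex (-?R) pi)) f"
      using contour_f(2)[OF n] contour_integral_rectpath[OF continuous_on_subset[OF holomorphic_on_imp_continuous_on[OF holo_f] contour_f(1)[OF n]]] R0
      unfolding h1 h2 by simp
    moreover have "A = V - V'" if "A = X - Y + C" "C = Y + V - X - V'" for A C X Y V V' :: complex
      using that by simp
    ultimately have "integral {-?R..?R} ?g - ?c
      = contour_integral (linepath (Complex ?R (-pi)) (Complex ?R pi)) f - contour_integral (linepath (Complex (-?R) (-pi)) (Complex (-?R) pi)) f"
      by blast
    also have "norm \<dots> \<le> ?b n + ?b n"
      by (rule order_trans[OF norm_triangle_ineq4 add_mono]; rule vertical_bound[OF n]) auto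
    finally show ?thesis by (simp only: mult_2)
  qed
  moreover have "eventually (\<lambda>n. \<bar>Re w\<bar> < real n) sequentially"
    by real_asymp
  ultimately have ev: "eventually (\<lambda>n. norm (integral {- real n..real n} ?g - ?c) \<le> 2 * ?b n) sequentially"
    by (auto elim: eventually_mono)
  have "(\<lambda>n. 2 * ?b n) \<longlonglongrightarrow> 0" by real_asymp
  then have "(\<lambda>n. integral {- real n..real n} ?g - ?c) \<longlonglongrightarrow> 0"
    by (rule Lim_null_comparison[OF ev])
  then show ?thesis by (simp add: LIM_zero_iff)
qed

end

text \<open>The reflection hypothesis \<open>cnj\<close> makes the difference of the values of T on
  the two lines equal to 2 i times an imaginary part, so a single real density remains. At w = 0 the
  two poles of the contour argument collide; there both sides vanish.\<close>

lemma pot_boundary_values: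
  fixes T :: "complex \<Rightarrow> complex"
  assumes \<eta>: "0 < \<eta>" and T: "T holomorphic_on {z. \<bar>Im z\<bar> < pi + \<eta>}"
    and B: "\<And>z. \<bar>Im z\<bar> \<le> pi \<Longrightarrow> norm (T z) \<le> B" and T0: "T 0 = 0"
    and cnj: "\<And>x. T (of_real x - \<i> * of_real pi) = cnj (T (of_real x + \<i> * of_real pi))"
    and w: "w \<in> strip"
  shows "T w = pot (\<lambda>x. Im (T (of_real x + \<i> * of_real pi)) / pi) w"
proof (cases "w = 0")
  case True
  then show ?thesis by (simp add: T0 pot_def kernel_integrand_def)
next
  case False
  define \<Psi> where "\<Psi> x = Im (T (of_real x + \<i> * of_real pi)) / pi" for x
  have "continuous_on UNIV (\<lambda>x. T (of_real x + \<i> * of_real pi))"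
    by (rule continuous_on_compose2[OF holomorphic_on_imp_continuous_on[OF T]])
       (use \<eta> in \<open>auto intro!: continuous_intros\<close>)
  then have "continuous_on UNIV \<Psi>"
    unfolding \<Psi>_def by (intro continuous_intros) auto
  then have m [measurable]: "\<Psi> \<in> borel_measurable borel" by (rule borel_measurable_continuous_onI)
  have b: "\<bar>\<Psi> x\<bar> \<le> B / pi" for x
    using abs_Im_le_cmod[of "T (of_real x + \<i> * of_real pi)"] B[of "of_real x + \<i> * of_real pi"]
    by (simp add: \<Psi>_def divide_right_mono)
  let ?h = "\<lambda>x. of_real (\<Psi> x) * sech_pair w 0 x"
  let ?g = "\<lambda>x. (T (of_real x + \<i> * of_real pi) - T (of_real x - \<i> * of_real pi)) * sech_pair w 0 x"
  have g: "?g x = 2 * \<i> * of_real pi * ?h x" for x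
    by (simp add: cnj complex_diff_cnj \<Psi>_def)
  have int: "integrable lborel ?h" using integrable_sech_pair[OF m b w] by simp
  then have intg: "integrable lborel ?g" unfolding g by simp
  \<comment> \<open>The residue argument yields only a limit of integrals over [-n, n]; absolute
    integrability identifies it with the integral over the line.\<close>
  have lim: "(\<lambda>n. LINT x|lborel. indicator {- real n..real n} x *\<^sub>R ?g x) \<longlonglongrightarrow> (LINT x|lborel. ?g x)"
  proof (rule integral_dominated_convergence)
    show "integrable lborel (\<lambda>x. norm (?g x))" using intg by (rule integrable_norm)
    show "AE x in lborel. (\<lambda>n. indicator {- real n..real n} x *\<^sub>R ?g x) \<longlonglongrightarrow> ?g x"
    proof (rule AE_I2, rule tendsto_eventually)
      fix x
      have "eventually (\<lambda>n. \<bar>x\<bar> \<le> real n) sequentially" by real_asymp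
      then show "eventually (\<lambda>n. indicator {- real n..real n} x *\<^sub>R ?g x = ?g x) sequentially"
        by eventually_elim (auto simp: indicator_def)
    qed
  qed (use intg in \<open>auto simp: indicator_def\<close>)
  have eq: "(LINT x|lborel. indicator {- real n..real n} x *\<^sub>R ?g x) = integral {- real n..real n} ?g" for n
  proof -
    have "set_integrable lborel {- real n..real n} ?g"
      unfolding set_integrable_def by (intro integrable_mult_indicator intg) auto
    from set_borel_integral_eq_integral(2)[OF this] show ?thesis
      by (simp add: set_lebesgue_integral_def)
  qed
  have "(LINT x|lborel. ?g x) = 4 * pi * \<i> * T w / sinh (w / 2)"
    using LIMSEQ_unique[OF lim] cauchy_strip_limit[OF \<eta> T B T0 w False] unfolding eq by blast
  then have "2 * \<i> * of_real pi * (LINT x|lborel. ?h x) = 2 * \<i> * of_real pi * (2 * T w / sinh (w / 2))"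
    unfolding g by simp
  then have "(LINT x|lborel. ?h x) = 2 * T w / sinh (w / 2)"
    by (subst (asm) mult_cancel_left) simp
  moreover have "sinh (w / 2) \<noteq> 0"
  proof -
    have "\<bar>Im (w / 2)\<bar> < pi" using w pi_gt_zero unfolding strip_def by (auto simp: abs_if)
    then show ?thesis using sinh_eq_0_imp[of "w / 2"] False by auto
  qed
  moreover have "pot \<Psi> w = 1 / 2 * (sinh (w / 2) * (LINT x|lborel. ?h x))"
    unfolding pot_def kernel_integrand_eq by simp
  ultimately have "pot \<Psi> w = T w" by simp
  then show ?thesis by (simp add: \<Psi>_def[abs_def])
qed

subsection \<open>Weak limits of bounded densities\<close>

lemma prob_space_logistic: "prob_space (density lborel (\<lambda>x. ennreal (logistic x)))"
proof (rule prob_spaceI)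
  show "emeasure (density lborel (\<lambda>x. ennreal (logistic x))) (space (density lborel (\<lambda>x. ennreal (logistic x)))) = 1"
    using has_bochner_integral_logistic logistic_pos
    by (simp add: emeasure_density has_bochner_integral_iff nn_integral_eq_integral less_imp_le)
qed

text \<open>Inner regularity reduces the comparison of measures to compact sets, whose indicator is a limit of
  bounded continuous functions.\<close>

lemma emeasure_le_of_continuous_integral_le:
  fixes M N :: "real measure"
  assumes M: "finite_measure M" "sets M = sets borel" and N: "finite_measure N" "sets N = sets borel"
    and c: "0 \<le> c"
    and le: "\<And>f :: real \<Rightarrow> real. continuous_on UNIV f \<Longrightarrow> (\<And>x. 0 \<le> f x \<and> f x \<le> 1) \<Longrightarrow> integral\<^sup>L M f \<le> c * integral\<^sup>L N f"
    and A: "A \<in> sets borel"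
  shows "emeasure M A \<le> ennreal c * emeasure N A"
proof -
  interpret M: finite_measure M by fact
  interpret N: finite_measure N by fact
  have comp: "emeasure M K \<le> ennreal c * emeasure N K" if K: "compact K" for K
  \<comment> \<open>By convention \<open>infdist\<close> to the empty set is 0, so for empty K the
    functions \<open>f k\<close> would be constantly 1 and not approach the indicator.\<close>
  proof (cases "K = {}")
    case False
    have clK: "closed K" using K by (rule compact_imp_closed)
    have KM: "K \<in> sets M" "K \<in> sets N" using clK M N by auto
    define f where "f k x = max 0 (1 - real k * infdist x K)" for k x
    have cf: "continuous_on UNIV (f k)" for k
      unfolding f_def by (intro continuous_intros)
    have fb: "0 \<le> f k x \<and> f k x \<le> 1" for k x
      by (simp add: f_def infdist_nonneg)
    have fm: "f k \<in> borel_measurable borel" for k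
      using cf by (rule borel_measurable_continuous_onI)
    have fmM: "f k \<in> borel_measurable M" "f k \<in> borel_measurable N" for k
      using fm measurable_cong_sets[OF M(2) refl] measurable_cong_sets[OF N(2) refl] by blast+
    have "(\<lambda>k. integral\<^sup>L N (f k)) \<longlonglongrightarrow> integral\<^sup>L N (indicator K)"
    proof (rule integral_dominated_convergence[where w = "\<lambda>_. 1"])
      show "AE x in N. (\<lambda>k. f k x) \<longlonglongrightarrow> indicator K x"
      proof (rule AE_I2)
        fix x
        show "(\<lambda>k. f k x) \<longlonglongrightarrow> indicator K x"
        proof (cases "x \<in> K")
          case True then show ?thesis by (simp add: f_def)
        next
          case nx: False
          then have d: "0 < infdist x K" using clK False infdist_pos_not_in_closed by blast
          obtain k0 where k0: "1 < real k0 * infdist x K" using reals_Archimedean3[OF d] by blast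
          have "f k x = 0" if "k \<ge> k0" for k
          proof -
            have "real k0 * infdist x K \<le> real k * infdist x K" using that d by (intro mult_right_mono) auto
            with k0 show ?thesis by (simp add: f_def)
          qed
          then have "eventually (\<lambda>k. f k x = indicator K x) sequentially"
            using nx by (auto simp: eventually_sequentially)
          then show ?thesis by (rule tendsto_eventually)
        qed
      qed
    qed (use fmM KM fb in auto)
    moreover have "measure M K \<le> c * integral\<^sup>L N (f k)" for k
    proof -
      have "measure M K = integral\<^sup>L M (indicator K)" using KM by simp
      also have "\<dots> \<le> integral\<^sup>L M (f k)"
      proof (rule integral_mono)
        show "integrable M (f k)"
          by (rule M.integrable_const_bound[where B = 1]) (use fb fmM in auto)
        show "indicator K x \<le> f k x" for x
          using fb by (auto simp: indicator_def f_def)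
        show "integrable M (indicator K :: real \<Rightarrow> real)"
          using KM by (intro integrable_real_indicator) (auto simp: M.emeasure_finite less_top[symmetric])
      qed
      also have "\<dots> \<le> c * integral\<^sup>L N (f k)" by (rule le[OF cf fb])
      finally show ?thesis .
    qed
    ultimately have "measure M K \<le> c * integral\<^sup>L N (indicator K)"
      by (intro LIMSEQ_le_const[OF tendsto_mult[OF tendsto_const]]) auto
    then have "measure M K \<le> c * measure N K" using KM by simp
    then show ?thesis
      using c by (simp add: M.emeasure_eq_measure N.emeasure_eq_measure flip: ennreal_mult)
  qed simp
  have "emeasure M A = (SUP K \<in> {K. K \<subseteq> A \<and> compact K}. emeasure M K)"
    by (rule inner_regular) (use M A M.emeasure_finite in auto)
  also have "\<dots> \<le> ennreal c * emeasure N A"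
  proof (rule SUP_least)
    fix K assume K: "K \<in> {K. K \<subseteq> A \<and> compact K}"
    then have "emeasure M K \<le> ennreal c * emeasure N K" using comp by blast
    also have "\<dots> \<le> ennreal c * emeasure N A"
      using K A N by (intro mult_left_mono emeasure_mono) auto
    finally show "emeasure M K \<le> ennreal c * emeasure N A" .
  qed
  finally show ?thesis .
qed

text \<open>The Radon-Nikodym derivative is at most c almost everywhere; truncating it at c changes
  it on a null set and makes the bound hold at every point, the form in which densities are handled
  throughout.\<close>

lemma bounded_density_exists:
  assumes M: "finite_measure M" and N: "finite_measure N" "sets M = sets N"
    and c: "0 \<le> c" and le: "\<And>A. A \<in> sets N \<Longrightarrow> emeasure M A \<le> ennreal c * emeasure N A"
  obtains D :: "'a \<Rightarrow> real" where "D \<in> borel_measurable N" "\<And>x. 0 \<le> D x \<and> D x \<le> c"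
    "M = density N (\<lambda>x. ennreal (D x))"
proof -
  interpret N: finite_measure N by fact
  have "absolutely_continuous N M"
    unfolding absolutely_continuous_def
  proof
    fix A assume A: "A \<in> null_sets N"
    then have "emeasure M A \<le> ennreal c * emeasure N A" by (intro le) auto
    then show "A \<in> null_sets M" using A N by (auto simp: null_sets_def)
  qed
  then have M_eq: "density N (RN_deriv N M) = M"
    using N by (intro N.density_RN_deriv) auto
  define f where "f = RN_deriv N M"
  have fm [measurable]: "f \<in> borel_measurable N" unfolding f_def by simp
  have "AE x in N. f x \<le> ennreal c"
  proof -
    \<comment> \<open>On the set A where the derivative exceeds c + 1 / (n + 1) one has (c + 1 / (n
      + 1)) N(A) \<le> M(A) \<le> c N(A), and finiteness of N forces N(A) = 0.\<close>
    have "AE x in N. \<forall>n. f x \<le> ennreal (c + 1 / real (Suc n))"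
    proof (rule AE_all_countable[THEN iffD2], rule allI)
      fix n
      let ?e = "1 / real (Suc n)"
      let ?A = "{x \<in> space N. ennreal (c + ?e) < f x}"
      have A: "?A \<in> sets N" by measurable
      have "ennreal (c + ?e) * emeasure N ?A = (\<integral>\<^sup>+x. ennreal (c + ?e) * indicator ?A x \<partial>N)"
        using A by (simp add: nn_integral_cmult_indicator)
      also have "\<dots> \<le> (\<integral>\<^sup>+x. f x * indicator ?A x \<partial>N)"
        by (intro nn_integral_mono) (auto simp: indicator_def)
      also have "\<dots> = emeasure M ?A" using A M_eq emeasure_density[OF fm A] by (simp add: f_def)
      also have "\<dots> \<le> ennreal c * emeasure N ?A" by (rule le[OF A])
      finally have "ennreal ((c + ?e) * measure N ?A) \<le> ennreal (c * measure N ?A)"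
        using c by (simp add: N.emeasure_eq_measure ennreal_mult)
      then have "(c + ?e) * measure N ?A \<le> c * measure N ?A"
        using c by (subst (asm) ennreal_le_iff) auto
      then have "?e * measure N ?A \<le> 0" by (simp add: algebra_simps)
      then have "measure N ?A = 0"
        using measure_nonneg[of N ?A] by (auto simp: divide_le_0_iff intro: antisym)
      then have "?A \<in> null_sets N" using A by (auto simp: N.emeasure_eq_measure)
      then show "AE x in N. f x \<le> ennreal (c + ?e)"
        by (rule AE_I') (auto simp: not_le)
    qed
    then show ?thesis
    proof eventually_elim
      case (elim x)
      have "(\<lambda>n. ennreal (c + 1 / real (Suc n))) \<longlonglongrightarrow> ennreal (c + 0)"
        by (intro tendsto_ennrealI tendsto_intros LIMSEQ_Suc[OF lim_1_over_n])
      then show ?case using elim by (intro LIMSEQ_le_const[of _ "ennreal c"]) auto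
    qed
  qed
  then have AE: "AE x in N. f x = ennreal (min c (enn2real (f x)))"
  proof eventually_elim
    case (elim x)
    have "f x < \<infinity>" using elim by (rule le_less_trans) simp
    then have "f x = ennreal (enn2real (f x))" by (simp add: less_top)
    moreover have "enn2real (f x) \<le> c" using elim c by (rule enn2real_leI[rotated])
    ultimately show ?case by (simp add: min_absorb2)
  qed
  show thesis
  proof (rule that)
    show "(\<lambda>x. min c (enn2real (f x))) \<in> borel_measurable N" by measurable
    have "density N f = density N (\<lambda>x. ennreal (min c (enn2real (f x))))"
      by (rule density_cong) (use AE in auto)
    then show "M = density N (\<lambda>x. ennreal (min c (enn2real (f x))))"
      using M_eq by (simp add: f_def)
  qed (use c in auto)
qed

text \<open>Weak-star sequential compactness of a ball of bounded functions, by way of probability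
  measures. Domination of all \<mu>_n by twice the logistic law \<kappa> does two things: it gives
  tightness, and it passes to the weak limit, which is thus absolutely continuous with a density D
  between 0 and 2 relative to \<kappa>.\<close>

lemma weak_star_subsequence:
  fixes \<Psi> :: "nat \<Rightarrow> real \<Rightarrow> real"
  assumes \<Psi> [measurable]: "\<And>n. \<Psi> n \<in> borel_measurable borel" and b: "\<And>n x. \<bar>\<Psi> n x\<bar> \<le> 1 / 2"
    and odd: "\<And>n x. \<Psi> n (- x) = - \<Psi> n x"
  obtains \<Phi> s where "\<Phi> \<in> borel_measurable borel" "\<And>x. \<bar>\<Phi> x\<bar> \<le> 1 / 2" "strict_mono (s :: nat \<Rightarrow> nat)"
    "\<And>(g :: real \<Rightarrow> complex) C. (\<And>x. isCont g x) \<Longrightarrow> (\<And>x. norm (g x) \<le> C) \<Longrightarrow>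
      (\<lambda>n. LINT x|lborel. (\<Psi> (s n) x * logistic x) *\<^sub>R g x) \<longlonglongrightarrow> (LINT x|lborel. (\<Phi> x * logistic x) *\<^sub>R g x)"
proof -
  define \<kappa> where "\<kappa> = density lborel (\<lambda>x. ennreal (logistic x))"
  define \<mu> where "\<mu> n = density lborel (\<lambda>x. ennreal ((1 + 2 * \<Psi> n x) * logistic x))" for n
  interpret \<kappa>: prob_space \<kappa> unfolding \<kappa>_def by (rule prob_space_logistic)
  have sets: "sets \<kappa> = sets borel" "space \<kappa> = UNIV" "sets (\<mu> n) = sets borel" "space (\<mu> n) = UNIV" for n
    by (simp_all add: \<kappa>_def \<mu>_def)
  have bnd: "0 \<le> 1 + 2 * \<Psi> n x" "1 + 2 * \<Psi> n x \<le> 2" for n x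
    using b[of n x] by linarith+
  have nn: "0 \<le> (1 + 2 * \<Psi> n x) * logistic x" for n x
    by (rule mult_nonneg_nonneg[OF bnd(1) less_imp_le[OF logistic_pos]])
  have logi: "integrable lborel logistic" "(LINT x|lborel. logistic x) = 1"
    using has_bochner_integral_logistic by (auto simp: has_bochner_integral_iff)
  have int_log: "integrable lborel (\<lambda>x. (h x * logistic x) *\<^sub>R g x)"
    if [measurable]: "h \<in> borel_measurable borel" "g \<in> borel_measurable borel"
      and h: "\<And>x. \<bar>h x\<bar> \<le> H" and g: "\<And>x. norm (g x) \<le> C" for h :: "real \<Rightarrow> real" and g :: "real \<Rightarrow> complex" and H C
  proof (rule Bochner_Integration.integrable_bound)
    show "integrable lborel (\<lambda>x. H * C * logistic x)" using logi by simp
    have "norm ((h x * logistic x) *\<^sub>R g x) \<le> norm (H * C * logistic x)" for x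
    proof -
      have "\<bar>h x\<bar> * norm (g x) \<le> H * C" using h[of x] g[of x] by (intro mult_mono) auto
      then have "\<bar>h x\<bar> * norm (g x) * logistic x \<le> H * C * logistic x"
        using logistic_pos[of x] by (intro mult_right_mono) auto
      also have "\<dots> \<le> norm (H * C * logistic x)" by simp
      finally show ?thesis using logistic_pos[of x] by (simp add: abs_mult ac_simps)
    qed
    then show "AE x in lborel. norm ((h x * logistic x) *\<^sub>R g x) \<le> norm (H * C * logistic x)" by simp
  qed measurable
  have int\<Psi>: "integrable lborel (\<lambda>x. \<Psi> n x * logistic x)" for n
  proof (rule Bochner_Integration.integrable_bound[OF logi(1)])
    have "\<bar>\<Psi> n x\<bar> * logistic x \<le> 1 * logistic x" for x
      using b[of n x] logistic_pos[of x] by (intro mult_right_mono) auto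
    then show "AE x in lborel. norm (\<Psi> n x * logistic x) \<le> norm (logistic x)"
      using logistic_pos by (simp add: abs_mult less_imp_le)
  qed measurable
  \<comment> \<open>\<Psi> n is odd and the logistic density even; hence the weight 1 + 2 \<Psi> n
    leaves the total mass at 1.\<close>
  have zero: "(LINT x|lborel. \<Psi> n x * logistic x) = 0" for n
  proof -
    have "(LINT x|lborel. \<Psi> n x * logistic x) = (LINT x|lborel. \<Psi> n (- x) * logistic (- x))"
      using lborel_integral_real_affine[of "-1" "\<lambda>x. \<Psi> n x * logistic x" 0] by simp
    also have "\<dots> = - (LINT x|lborel. \<Psi> n x * logistic x)"
      by (simp add: odd logistic_def)
    finally show ?thesis by simp
  qed
  have dist: "real_distribution (\<mu> n)" for n
  proof -
    have "prob_space (\<mu> n)"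
    proof (rule prob_spaceI)
      have "emeasure (\<mu> n) (space (\<mu> n)) = (\<integral>\<^sup>+x. ennreal ((1 + 2 * \<Psi> n x) * logistic x) \<partial>lborel)"
        by (simp add: \<mu>_def emeasure_density)
      also have "\<dots> = ennreal (LINT x|lborel. (1 + 2 * \<Psi> n x) * logistic x)"
      proof (intro nn_integral_eq_integral AE_I2 nn)
        show "integrable lborel (\<lambda>x. (1 + 2 * \<Psi> n x) * logistic x)"
          using int\<Psi>[of n] logi by (simp add: distrib_right mult.assoc)
      qed
      also have "(LINT x|lborel. (1 + 2 * \<Psi> n x) * logistic x) = 1"
        using int\<Psi>[of n] logi by (simp add: distrib_right mult.assoc zero)
      finally show "emeasure (\<mu> n) (space (\<mu> n)) = 1" by simp
    qed
    then show ?thesis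
      by (simp add: real_distribution_def real_distribution_axioms_def sets)
  qed
  have le: "emeasure (\<mu> n) A \<le> ennreal 2 * emeasure \<kappa> A" if A: "A \<in> sets borel" for n A
  proof -
    have "emeasure (\<mu> n) A = (\<integral>\<^sup>+x. ennreal ((1 + 2 * \<Psi> n x) * logistic x) * indicator A x \<partial>lborel)"
      using A by (simp add: \<mu>_def emeasure_density)
    also have "\<dots> \<le> (\<integral>\<^sup>+x. ennreal 2 * (ennreal (logistic x) * indicator A x) \<partial>lborel)"
    proof (rule nn_integral_mono)
      fix x
      have "ennreal ((1 + 2 * \<Psi> n x) * logistic x) \<le> ennreal 2 * ennreal (logistic x)"
        using bnd[of n x] logistic_pos[of x]
        by (subst ennreal_mult[symmetric]) (auto intro!: ennreal_leI mult_right_mono)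
      then show "ennreal ((1 + 2 * \<Psi> n x) * logistic x) * indicator A x \<le> ennreal 2 * (ennreal (logistic x) * indicator A x)"
        by (auto simp: indicator_def)
    qed
    also have "\<dots> = ennreal 2 * emeasure \<kappa> A"
      using A by (simp add: \<kappa>_def emeasure_density nn_integral_cmult)
    finally show ?thesis .
  qed
  have "tight \<mu>"
    unfolding tight_def
  proof (intro conjI allI impI)
    fix e :: real assume e: "0 < e"
    have "(\<lambda>k. measure \<kappa> {- real (Suc k)<..real (Suc k)}) \<longlonglongrightarrow> measure \<kappa> (\<Union>k. {- real (Suc k)<..real (Suc k)})"
      by (rule \<kappa>.finite_Lim_measure_incseq) (auto simp: sets incseq_def)
    also have "(\<Union>k. {- real (Suc k)<..real (Suc k)}) = UNIV"
    proof -
      have "x \<in> (\<Union>k. {- real (Suc k)<..real (Suc k)})" for x :: real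
      proof -
        obtain k where "\<bar>x\<bar> < real k" using reals_Archimedean2 by blast
        then have "x \<in> {- real (Suc k)<..real (Suc k)}" by auto
        then show ?thesis by blast
      qed
      then show ?thesis by blast
    qed
    \<comment> \<open>The margin e / 2 anticipates that the mass of the complement may double on
      passing from \<kappa> to \<mu> n.\<close>
    finally have "eventually (\<lambda>k. 1 - e / 2 < measure \<kappa> {- real (Suc k)<..real (Suc k)}) sequentially"
      using \<kappa>.prob_space e sets by (intro order_tendstoD(1)) auto
    then obtain k where k: "1 - e / 2 < measure \<kappa> {- real (Suc k)<..real (Suc k)}"
      unfolding eventually_sequentially by blast
    let ?I = "{- real (Suc k)<..real (Suc k)}"
    show "\<exists>a b. a < b \<and> (\<forall>n. 1 - e < measure (\<mu> n) {a<..b})"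
    proof (rule exI[of _ "- real (Suc k)"], rule exI[of _ "real (Suc k)"], intro conjI allI)
      fix n
      interpret \<mu>: real_distribution "\<mu> n" by (rule dist)
      have "emeasure (\<mu> n) (UNIV - ?I) \<le> ennreal 2 * emeasure \<kappa> (UNIV - ?I)" by (rule le) auto
      then have "ennreal (measure (\<mu> n) (UNIV - ?I)) \<le> ennreal (2 * measure \<kappa> (UNIV - ?I))"
        by (simp add: \<mu>.emeasure_eq_measure \<kappa>.emeasure_eq_measure ennreal_mult)
      then have "measure (\<mu> n) (UNIV - ?I) \<le> 2 * measure \<kappa> (UNIV - ?I)"
        by (subst (asm) ennreal_le_iff) auto
      moreover have "measure (\<mu> n) (UNIV - ?I) = 1 - measure (\<mu> n) ?I"
        using \<mu>.prob_compl[of ?I] sets by simp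
      moreover have "measure \<kappa> (UNIV - ?I) = 1 - measure \<kappa> ?I"
        using \<kappa>.prob_compl[of ?I] sets by simp
      ultimately show "1 - e < measure (\<mu> n) ?I" using k by linarith
    qed simp
  qed (rule dist)
  from tight_imp_convergent_subsubsequence[OF this, of id] obtain s M where s: "strict_mono s"
    and M: "real_distribution M" and conv: "weak_conv_m (\<mu> \<circ> s) M"
    by (auto simp: strict_mono_def)
  interpret M: real_distribution M by fact
  have lim: "(\<lambda>n. integral\<^sup>L (\<mu> (s n)) g) \<longlonglongrightarrow> integral\<^sup>L M g"
    if "\<And>x. isCont g x" "\<And>x. norm (g x) \<le> C" for g :: "real \<Rightarrow> 'b::{banach, second_countable_topology}" and C
    using weak_conv_imp_integral_bdd_continuous_conv[of "\<mu> \<circ> s" M g C] dist M conv that by (auto simp: comp_def)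
  \<comment> \<open>Weak convergence does not preserve an inequality set by set, so the domination
    is passed to the limit for continuous functions and only then restored on Borel sets.\<close>
  have "emeasure M A \<le> ennreal 2 * emeasure \<kappa> A" if "A \<in> sets borel" for A
  proof (rule emeasure_le_of_continuous_integral_le[OF M.finite_measure_axioms _ \<kappa>.finite_measure_axioms sets(1) _ _ that])
    fix f :: "real \<Rightarrow> real" assume cf: "continuous_on UNIV f" and fb: "\<And>x. 0 \<le> f x \<and> f x \<le> 1"
    have [measurable]: "f \<in> borel_measurable borel" using cf by (rule borel_measurable_continuous_onI)
    have "integral\<^sup>L (\<mu> n) f \<le> 2 * integral\<^sup>L \<kappa> f" for n
    proof -
      have i2: "integrable lborel (\<lambda>x. 2 * (logistic x * f x))"
        by (rule Bochner_Integration.integrable_bound[OF integrable_mult_right[OF logi(1), of 2]])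
           (use fb logistic_pos in \<open>auto simp: abs_mult less_imp_le intro!: AE_I2 mult_left_le\<close>)
      have le2: "(1 + 2 * \<Psi> n x) * logistic x * f x \<le> 2 * (logistic x * f x)" for x
        using bnd[of n x] logistic_pos[of x] fb[of x]
        by (simp only: mult.assoc) (intro mult_right_mono mult_nonneg_nonneg, auto)
      have "integral\<^sup>L (\<mu> n) f = (LINT x|lborel. (1 + 2 * \<Psi> n x) * logistic x * f x)"
        unfolding \<mu>_def using nn by (subst integral_density) (auto intro!: AE_I2)
      also have "\<dots> \<le> (LINT x|lborel. 2 * (logistic x * f x))"
      proof (rule integral_mono[OF _ i2 le2])
        have nnf: "0 \<le> (1 + 2 * \<Psi> n x) * logistic x * f x" for x
          by (rule mult_nonneg_nonneg[OF nn conjunct1[OF fb]])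
        have norm_le: "norm a \<le> norm b" if "0 \<le> a" "a \<le> b" for a b :: real using that by simp
        show "integrable lborel (\<lambda>x. (1 + 2 * \<Psi> n x) * logistic x * f x)"
          by (rule Bochner_Integration.integrable_bound[OF i2 _ AE_I2[OF norm_le[OF nnf le2]]]) measurable
      qed
      also have "\<dots> = 2 * integral\<^sup>L \<kappa> f"
        unfolding \<kappa>_def using logistic_pos
        by (subst integral_density) (auto simp: less_imp_le)
      finally show ?thesis .
    qed
    then show "integral\<^sup>L M f \<le> 2 * integral\<^sup>L \<kappa> f"
      using cf fb by (intro LIMSEQ_le_const2[OF lim[of f 1]]) (auto simp: continuous_on_eq_continuous_at)
  qed simp_all
  then obtain D where D: "D \<in> borel_measurable \<kappa>" "\<And>x. 0 \<le> D x \<and> D x \<le> 2" "M = density \<kappa> (\<lambda>x. ennreal (D x))"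
    using bounded_density_exists[OF M.finite_measure_axioms \<kappa>.finite_measure_axioms, of 2] sets by auto
  have Dm [measurable]: "D \<in> borel_measurable borel"
    using D(1) measurable_cong_sets[OF sets(1) refl] by blast
  have M_eq: "M = density lborel (\<lambda>x. ennreal (D x * logistic x))"
    using D(2) logistic_pos unfolding D(3) \<kappa>_def
    by (subst density_density_eq) (auto simp: ennreal_mult mult.commute less_imp_le intro!: density_cong)
  show thesis
  \<comment> \<open>This inverts h \<mapsto> 1 + 2 h; the range of D between 0 and 2 becomes the
    range between -1 / 2 and 1 / 2.\<close>
  proof (rule that[of "\<lambda>x. (D x - 1) / 2" s])
    show "\<bar>(D x - 1) / 2\<bar> \<le> 1 / 2" for x using D(2)[of x] by auto
    fix g :: "real \<Rightarrow> complex" and C assume g: "\<And>x. isCont g x" "\<And>x. norm (g x) \<le> C"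
    have gm [measurable]: "g \<in> borel_measurable borel"
      using g by (intro borel_measurable_continuous_onI) (auto simp: continuous_on_eq_continuous_at)
    \<comment> \<open>An integral against the signed density h is half the difference between the
      positive weight 1 + 2 h and the fixed reference weight 1, so convergence for the former
      suffices.\<close>
    have e: "(LINT x|lborel. (h x * logistic x) *\<^sub>R g x)
        = ((LINT x|lborel. ((1 + 2 * h x) * logistic x) *\<^sub>R g x) - (LINT x|lborel. (1 * logistic x) *\<^sub>R g x)) / 2"
      if h [measurable]: "h \<in> borel_measurable borel" and hb: "\<And>x. \<bar>h x\<bar> \<le> 1 / 2" for h
    proof -
      have "(LINT x|lborel. ((1 + 2 * h x) * logistic x) *\<^sub>R g x) - (LINT x|lborel. (1 * logistic x) *\<^sub>R g x)
        = (LINT x|lborel. ((1 + 2 * h x) * logistic x) *\<^sub>R g x - (1 * logistic x) *\<^sub>R g x)"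
      proof (rule Bochner_Integration.integral_diff[symmetric])
        show "integrable lborel (\<lambda>x. ((1 + 2 * h x) * logistic x) *\<^sub>R g x)"
        proof (rule int_log[OF _ gm _ g(2)])
          show "\<bar>1 + 2 * h x\<bar> \<le> 2" for x using hb[of x] by (simp add: abs_le_iff)
        qed measurable
        show "integrable lborel (\<lambda>x. (1 * logistic x) *\<^sub>R g x)"
          by (rule int_log[OF _ gm order_refl g(2)]) measurable
      qed
      also have "\<dots> = (LINT x|lborel. 2 * ((h x * logistic x) *\<^sub>R g x))"
        by (intro Bochner_Integration.integral_cong) (auto simp: algebra_simps scaleR_conv_of_real)
      also have "\<dots> = 2 * (LINT x|lborel. (h x * logistic x) *\<^sub>R g x)" by (rule integral_mult_right_zero)
      finally show ?thesis by simp
    qed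
    have "(\<lambda>n. integral\<^sup>L (\<mu> (s n)) g) \<longlonglongrightarrow> integral\<^sup>L M g" using g by (rule lim)
    also have "(\<lambda>n. integral\<^sup>L (\<mu> (s n)) g) = (\<lambda>n. LINT x|lborel. ((1 + 2 * \<Psi> (s n) x) * logistic x) *\<^sub>R g x)"
      unfolding \<mu>_def using nn by (subst integral_density) (auto intro!: AE_I2)
    also have "integral\<^sup>L M g = (LINT x|lborel. ((1 + 2 * ((D x - 1) / 2)) * logistic x) *\<^sub>R g x)"
    proof -
      have "0 \<le> D x * logistic x" for x
        by (rule mult_nonneg_nonneg[OF conjunct1[OF D(2)] less_imp_le[OF logistic_pos]])
      moreover have eD: "1 + 2 * ((D x - 1) / 2) = D x" for x by (simp add: field_simps)
      ultimately show ?thesis unfolding M_eq eD by (subst integral_density) (auto intro!: AE_I2)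
    qed
    finally have lim_g: "(\<lambda>n. LINT x|lborel. ((1 + 2 * \<Psi> (s n) x) * logistic x) *\<^sub>R g x)
       \<longlonglongrightarrow> (LINT x|lborel. ((1 + 2 * ((D x - 1) / 2)) * logistic x) *\<^sub>R g x)" .
    have hm: "(\<lambda>x. (D x - 1) / 2) \<in> borel_measurable borel" by measurable
    have hb: "\<bar>(D x - 1) / 2\<bar> \<le> 1 / 2" for x using D(2)[of x] by auto
    show "(\<lambda>n. LINT x|lborel. (\<Psi> (s n) x * logistic x) *\<^sub>R g x) \<longlonglongrightarrow> (LINT x|lborel. ((D x - 1) / 2 * logistic x) *\<^sub>R g x)"
      unfolding e[OF \<Psi> b] e[OF hm hb] by (intro tendsto_intros lim_g) simp
  qed (use s in auto)
qed

subsection \<open>Representation of the class W\<close>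

lemma isCont_cosh_shift: "isCont (\<lambda>x::real. cosh ((w - of_real x) / 2 :: complex)) x"
  unfolding cosh_def by (intro continuous_intros) auto

text \<open>Apart from the factor sinh (w / 2), the kernel is the logistic density times
  \<open>g\<close>. The growth of (cosh (x / 2))^2 in \<open>g\<close> is cancelled by
  \<open>sech_pair w 0\<close>, so \<open>g\<close> is bounded and continuous and may serve as a
  test function.\<close>

lemma tendsto_pot_of_weak_star:
  assumes lim: "\<And>(g :: real \<Rightarrow> complex) C. (\<And>x. isCont g x) \<Longrightarrow> (\<And>x. norm (g x) \<le> C) \<Longrightarrow>
      (\<lambda>n. LINT x|lborel. (\<Psi> n x * logistic x) *\<^sub>R g x) \<longlonglongrightarrow> (LINT x|lborel. (\<Phi> x * logistic x) *\<^sub>R g x)"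
    and w: "w \<in> strip"
  shows "(\<lambda>n. pot (\<Psi> n) w) \<longlonglongrightarrow> pot \<Phi> w"
proof -
  define g where "g x = of_real (4 * (cosh (x / 2))\<^sup>2) * sech_pair w 0 x" for x
  have e: "kernel_integrand h w x = sinh (w / 2) * ((h x * logistic x) *\<^sub>R g x)" for h x
    by (simp add: kernel_integrand_eq g_def logistic_def scaleR_conv_of_real)
  have p: "pot h w = 1 / 2 * (sinh (w / 2) * (LINT x|lborel. (h x * logistic x) *\<^sub>R g x))" for h
    unfolding pot_def e integral_mult_right_zero ..
  have "(\<lambda>n. LINT x|lborel. (\<Psi> n x * logistic x) *\<^sub>R g x) \<longlonglongrightarrow> (LINT x|lborel. (\<Phi> x * logistic x) *\<^sub>R g x)"
  proof (rule lim)
    show "isCont g x" for x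
      unfolding g_def sech_pair_def
      by (intro continuous_intros isCont_cosh_shift) (use strip_cosh_nonzero[OF w] strip_cosh_nonzero[OF zero_in_strip] in auto)
    show "norm (g x) \<le> 4 * (sech_bound w * sech_bound 0)" for x
    proof -
      have "norm (g x) = 4 * (cosh (x / 2))\<^sup>2 * norm (sech_pair w 0 x)"
        by (simp add: g_def norm_mult norm_power)
      also have "\<dots> \<le> 4 * (cosh (x / 2))\<^sup>2 * (sech_bound w * sech_bound 0 / (cosh (x / 2))\<^sup>2)"
        by (intro mult_left_mono norm_sech_pair_le w) auto
      finally show ?thesis by simp
    qed
  qed
  then show ?thesis unfolding p by (intro tendsto_intros)
qed

section \<open>Reflection, periodicity and boundedness of elements of \<open>W p\<close>\<close>

lemma W_holomorphic: "S \<in> W p \<Longrightarrow> S holomorphic_on strip"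
  by (simp add: W_def analytic_imp_holomorphic)

lemma W_Im_bound:
  assumes S: "S \<in> W p" and "0 \<le> Im w" "Im w < pi"
  shows "\<bar>Im (S w)\<bar> \<le> 1 / 2 * Im w"
  using assms by (auto simp: W_def)

text \<open>At Im w = 0 the bound on Im S forces S to be real, so S and its reflection agree on the
  real axis and, by the identity theorem, on the strip.\<close>

lemma W_cnj:
  assumes S: "S \<in> W p" and w: "w \<in> strip"
  shows "S (cnj w) = cnj (S w)"
proof -
  have holo: "(\<lambda>w. S w - (cnj \<circ> S \<circ> cnj) w) holomorphic_on strip"
  proof (intro holomorphic_intros W_holomorphic[OF S])
    have "cnj ` strip = strip"
    proof
      show "strip \<subseteq> cnj ` strip"
        using cnj_in_strip by (metis complex_cnj_cnj image_eqI subsetI)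
    qed (use cnj_in_strip in auto)
    then show "cnj \<circ> S \<circ> cnj holomorphic_on strip"
      by (intro holomorphic_on_compose_cnj_cnj open_strip) (simp add: W_holomorphic[OF S])
  qed
  have "S (cnj w) - (cnj \<circ> S \<circ> cnj) (cnj w) = 0"
  proof (rule analytic_continuation[OF holo open_strip convex_connected[OF convex_strip], of "range of_real" 0])
    show "(0::complex) islimpt range of_real"
    proof (rule islimptI)
      fix T :: "complex set" assume T: "0 \<in> T" "open T"
      then obtain e where e: "0 < e" "ball 0 e \<subseteq> T" by (meson openE)
      then have "complex_of_real (e / 2) \<in> T" by (auto simp: subset_iff)
      then show "\<exists>y\<in>range of_real. y \<in> T \<and> y \<noteq> 0"
        using e by (intro bexI[of _ "complex_of_real (e / 2)"] rangeI) auto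
    qed
    fix z assume "z \<in> range complex_of_real"
    then obtain x where z: "z = of_real x" by blast
    have "Im (S z) = 0" using W_Im_bound[OF S, of z] z by simp
    moreover have "S (cnj z) = S z" using z by simp
    ultimately show "S z - (cnj \<circ> S \<circ> cnj) z = 0" by (simp add: complex_eq_iff)
  qed (use w cnj_in_strip in auto)
  then show ?thesis by simp
qed

lemma W_periodic_int:
  assumes S: "S \<in> W p" and w: "w \<in> strip"
  shows "S (w + of_int k * of_real p) = S w"
proof -
  have step: "S (z + of_real p) = S z" if "z \<in> strip" for z using S that by (auto simp: W_def)
  have inS: "w + of_int k * of_real p \<in> strip" for k
    using w by (simp add: strip_def)
  show ?thesis
  proof (induction k rule: int_induct[where k = 0])
    case (step1 i)
    then show ?case using step[OF inS[of i]] by (simp add: algebra_simps)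
  next
    case (step2 i)
    then show ?case using step[OF inS[of "i - 1"]] by (simp add: algebra_simps)
  qed simp
qed

text \<open>A translation by a multiple of p moves any point of the closed substrip into a compact
  rectangle of width p. Periodicity thus supplies the bound on the real part that the definition of
  \<open>W\<close> does not contain.\<close>

lemma W_bounded:
  assumes S: "S \<in> W p" and p: "0 < p" and h: "0 \<le> h" "h < pi"
  obtains B where "\<And>w. \<bar>Im w\<bar> \<le> h \<Longrightarrow> norm (S w) \<le> B"
proof -
  have sub: "cbox (Complex 0 (- h)) (Complex p h) \<subseteq> strip"
    using h by (auto simp: strip_def in_cbox_complex_iff)
  have "compact (S ` cbox (Complex 0 (- h)) (Complex p h))"
    by (intro compact_continuous_image continuous_on_subset[OF holomorphic_on_imp_continuous_on[OF W_holomorphic[OF S]] sub]) simp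
  then obtain B where B: "\<And>z. z \<in> cbox (Complex 0 (- h)) (Complex p h) \<Longrightarrow> norm (S z) \<le> B"
    by (meson compact_imp_bounded bounded_iff imageI)
  show thesis
  proof (rule that)
    fix w :: complex assume w: "\<bar>Im w\<bar> \<le> h"
    define k where "k = \<lfloor>Re w / p\<rfloor>"
    let ?z = "w + of_int (- k) * of_real p"
    have "real_of_int k \<le> Re w / p" "Re w / p < real_of_int k + 1" unfolding k_def by linarith+
    then have "0 \<le> Re ?z" "Re ?z \<le> p" using p by (simp_all add: field_simps)
    then have "norm (S ?z) \<le> B" using w by (intro B) (auto simp: in_cbox_complex_iff)
    moreover have "S ?z = S w" by (rule W_periodic_int[OF S]) (use w h in \<open>auto simp: strip_def\<close>)
    ultimately show "norm (S w) \<le> B" by simp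
  qed
qed

lemma dilation_in_strip:
  assumes "0 < r" "r < 1"
  shows "of_real r * (of_real x + \<i> * of_real pi) \<in> strip"
proof -
  have "0 < r * pi" "r * pi < 1 * pi"
    using assms by simp_all
  moreover from this have "- pi < r * pi" using pi_gt_zero by linarith
  ultimately show ?thesis by (simp add: strip_def)
qed

text \<open>The dilated function is defined where r |Im z| < pi, which leaves the margin pi / r - pi
  beyond the closed strip; on the closed strip its arguments satisfy |Im| \<le> r pi < pi, where S
  is bounded.\<close>

lemma W_dilation_eq_pot:
  assumes S: "S \<in> W p" and p: "0 < p" and r: "0 < r" "r < 1" and w: "w \<in> strip"
  shows "S (of_real r * w) = pot (\<lambda>x. Im (S (of_real r * (of_real x + \<i> * of_real pi))) / pi) w"
proof -
  obtain B where B: "\<And>w. \<bar>Im w\<bar> \<le> r * pi \<Longrightarrow> norm (S w) \<le> B"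
    using W_bounded[OF S p, of "r * pi"] r by auto
  show ?thesis
  proof (rule pot_boundary_values[where T = "\<lambda>w. S (of_real r * w)" and \<eta> = "pi / r - pi" and B = B])
    show "0 < pi / r - pi" using r by (simp add: field_simps)
    have "S \<circ> (\<lambda>w. of_real r * w) holomorphic_on {z. \<bar>Im z\<bar> < pi + (pi / r - pi)}"
      by (rule holomorphic_on_compose_gen[OF _ W_holomorphic[OF S]])
         (use r in \<open>auto intro!: holomorphic_intros simp: strip_def field_simps abs_less_iff\<close>)
    then show "(\<lambda>w. S (of_real r * w)) holomorphic_on {z. \<bar>Im z\<bar> < pi + (pi / r - pi)}"
      by (simp add: comp_def)
    show "norm (S (of_real r * z)) \<le> B" if "\<bar>Im z\<bar> \<le> pi" for z
      using that r by (intro B) (auto simp: abs_mult)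
    show "S (of_real r * 0) = 0" using S by (simp add: W_def)
    show "S (of_real r * (of_real x - \<i> * of_real pi)) = cnj (S (of_real r * (of_real x + \<i> * of_real pi)))" for x
    proof -
      have "of_real r * (of_real x + \<i> * of_real pi) \<in> strip"
        using r by (rule dilation_in_strip)
      from W_cnj[OF S this] show ?thesis by simp
    qed
  qed (rule w)
qed

text \<open>For fixed w both sides of the dilation formula converge as r tends to 1 along a
  subsequence: S (r w) by continuity of S at w, its transform by the weak convergence of the
  densities. Neither oddness nor periodicity of \<Phi> is claimed at this stage.\<close>

lemma W_eq_pot:
  assumes S: "S \<in> W p" and p: "0 < p"
  obtains \<Phi> where "\<Phi> \<in> borel_measurable borel" "\<And>x. \<bar>\<Phi> x\<bar> \<le> 1 / 2" "\<And>w. w \<in> strip \<Longrightarrow> S w = pot \<Phi> w"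
proof -
  \<comment> \<open>The shift by 2 makes the first value 1 / 2, so that every r n is
    positive.\<close>
  define r where "r n = 1 - 1 / real (n + 2)" for n
  have r: "0 < r n" "r n < 1" for n by (simp_all add: r_def field_simps)
  define \<Psi> where "\<Psi> n x = Im (S (of_real (r n) * (of_real x + \<i> * of_real pi))) / pi" for n x
  have inS: "of_real (r n) * (of_real x + \<i> * of_real pi) \<in> strip" for n x
    using r by (rule dilation_in_strip)
  have m: "\<Psi> n \<in> borel_measurable borel" for n
  proof (rule borel_measurable_continuous_onI)
    have "continuous_on UNIV (\<lambda>x. S (of_real (r n) * (of_real x + \<i> * of_real pi)))"
      by (rule continuous_on_compose2[OF holomorphic_on_imp_continuous_on[OF W_holomorphic[OF S]]])
         (use inS in \<open>auto intro!: continuous_intros\<close>)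
    then show "continuous_on UNIV (\<Psi> n)"
      unfolding \<Psi>_def by (intro continuous_intros) auto
  qed
  have b: "\<bar>\<Psi> n x\<bar> \<le> 1 / 2" for n x
  proof -
    have "\<bar>Im (S (of_real (r n) * (of_real x + \<i> * of_real pi)))\<bar> \<le> 1 / 2 * (r n * pi)"
      using W_Im_bound[OF S, of "of_real (r n) * (of_real x + \<i> * of_real pi)"] r[of n] by simp
    also have "\<dots> \<le> 1 / 2 * (1 * pi)" using r[of n] by (intro mult_left_mono mult_right_mono) auto
    finally show ?thesis by (simp add: \<Psi>_def field_simps)
  qed
  \<comment> \<open>Replacing x by -x sends the boundary point z to - cnj z, and evenness with
    reflection gives S (- cnj z) = cnj (S z).\<close>
  have odd: "\<Psi> n (- x) = - \<Psi> n x" for n x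
  proof -
    let ?z = "of_real (r n) * (of_real x + \<i> * of_real pi) :: complex"
    have "of_real (r n) * (of_real (- x) + \<i> * of_real pi) = - cnj ?z"
      by (simp add: algebra_simps)
    moreover have "S (- cnj ?z) = S (cnj ?z)" using S cnj_in_strip[OF inS] by (auto simp: W_def)
    ultimately show ?thesis using W_cnj[OF S inS[of n x]] by (simp add: \<Psi>_def)
  qed
  obtain \<Phi> s where \<Phi>: "\<Phi> \<in> borel_measurable borel" "\<And>x. \<bar>\<Phi> x\<bar> \<le> 1 / 2" and s: "strict_mono (s :: nat \<Rightarrow> nat)"
    and lim: "\<And>(g :: real \<Rightarrow> complex) C. (\<And>x. isCont g x) \<Longrightarrow> (\<And>x. norm (g x) \<le> C) \<Longrightarrow>
      (\<lambda>n. LINT x|lborel. (\<Psi> (s n) x * logistic x) *\<^sub>R g x) \<longlonglongrightarrow> (LINT x|lborel. (\<Phi> x * logistic x) *\<^sub>R g x)"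
    by (rule weak_star_subsequence[of \<Psi>, OF m b odd]) blast
  show thesis
  proof (rule that[OF \<Phi>])
    fix w assume w: "w \<in> strip"
    have "(\<lambda>n. pot (\<Psi> (s n)) w) \<longlonglongrightarrow> pot \<Phi> w"
      using lim w by (rule tendsto_pot_of_weak_star)
    moreover have "pot (\<Psi> n) w = S (of_real (r n) * w)" for n
      unfolding \<Psi>_def by (rule W_dilation_eq_pot[OF S p r w, symmetric])
    ultimately have 1: "(\<lambda>n. S (of_real (r (s n)) * w)) \<longlonglongrightarrow> pot \<Phi> w" by simp
    have "r \<longlonglongrightarrow> 1" unfolding r_def by real_asymp
    then have "(\<lambda>n. r (s n)) \<longlonglongrightarrow> 1" using LIMSEQ_subseq_LIMSEQ[OF _ s] by (simp add: comp_def)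
    then have "(\<lambda>n. of_real (r (s n)) * w) \<longlonglongrightarrow> of_real 1 * w" by (intro tendsto_intros)
    moreover have "isCont S w" using W_holomorphic[OF S] open_strip w
      by (meson continuous_on_eq_continuous_at holomorphic_on_imp_continuous_on)
    ultimately have "(\<lambda>n. S (of_real (r (s n)) * w)) \<longlonglongrightarrow> S w"
      using isCont_tendsto_compose by fastforce
    with 1 show "S w = pot \<Phi> w" using LIMSEQ_unique by blast
  qed
qed

subsection \<open>The correspondence\<close>

lemma AE_lborel_affine:
  fixes P :: "real \<Rightarrow> bool"
  assumes P: "AE x in lborel. P x" and c: "c \<noteq> 0"
  shows "AE x in lborel. P (t + c * x)"
proof -
  \<comment> \<open>P need not be measurable, so its exceptional set is first enclosed in a Borel
    null set, to which the change of variables applies.\<close>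
  obtain N where N: "{x \<in> space lborel. \<not> P x} \<subseteq> N" "N \<in> null_sets lborel"
    using P by (auto simp: eventually_ae_filter)
  have [measurable]: "N \<in> sets borel" using N(2) by (auto simp: null_sets_def)
  have "AE x in lborel. x \<notin> N" using N(2) by (rule AE_not_in)
  then have "AE x in lborel. t + c * x \<notin> N"
    by (intro AE_borel_affine[OF c, of "\<lambda>x. x \<notin> N"]) measurable
  then show ?thesis by eventually_elim (use N(1) in auto)
qed

lemma AE_lborel_uminus: "AE x in lborel. P x \<Longrightarrow> AE x in lborel. P (- x)" for P :: "real \<Rightarrow> bool"
  using AE_lborel_affine[of P "-1" 0] by simp

lemma AE_lborel_translate: "AE x in lborel. P x \<Longrightarrow> AE x in lborel. P (x + p)" for P :: "real \<Rightarrow> bool"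
  using AE_lborel_affine[of P 1 p] by (simp add: add.commute)

text \<open>A Lebesgue measurable function agrees almost everywhere with a Borel one, and clipping
  to [-1/2, 1/2] turns the essential bound into a pointwise bound. Oddness and periodicity carry
  over because reflections and translations preserve null sets.\<close>

lemma Psi_fun_borel_representative:
  assumes \<Psi>: "\<Psi> \<in> Psi_fun p"
  obtains \<Phi> where "\<Phi> \<in> borel_measurable borel" "\<And>x. \<bar>\<Phi> x\<bar> \<le> 1 / 2" "AE x in lborel. \<Psi> x = \<Phi> x"
    "AE x in lborel. \<Phi> (- x) = - \<Phi> x" "AE x in lborel. \<Phi> (x + p) = \<Phi> x"
proof -
  have m: "\<Psi> \<in> borel_measurable (completion lborel)" using \<Psi> by (simp add: Psi_fun_def Linfty_def)
  obtain g where g: "g \<in> borel_measurable lborel" "AE x in lborel. \<Psi> x = g x"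
    using completion_ex_borel_measurable_real[OF m] by blast
  have "AE x in lebesgue. ereal \<bar>\<Psi> x\<bar> \<le> Linfty_norm \<Psi>"
    unfolding Linfty_norm_def by (rule esssup_AE)
  then have "AE x in lborel. ereal \<bar>\<Psi> x\<bar> \<le> Linfty_norm \<Psi>" by (simp only: AE_completion_iff)
  then have b: "AE x in lborel. \<bar>\<Psi> x\<bar> \<le> 1 / 2"
  proof eventually_elim
    case (elim x)
    also have "Linfty_norm \<Psi> \<le> ereal (1 / 2)" using \<Psi> by (simp add: Psi_fun_def)
    finally show ?case by simp
  qed
  define \<Phi> where "\<Phi> x = max (- 1 / 2) (min (1 / 2) (g x))" for x
  have e: "AE x in lborel. \<Psi> x = \<Phi> x"
    using g(2) b by eventually_elim (auto simp: \<Phi>_def abs_le_iff)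
  have "AE x in lborel. \<Psi> (- x) = - \<Psi> x" "AE x in lborel. \<Psi> (x + p) = \<Psi> x"
    using \<Psi> by (simp_all add: Psi_fun_def AE_completion_iff)
  show thesis
  proof (rule that[OF _ _ e])
    show "\<Phi> \<in> borel_measurable borel" using g(1) unfolding \<Phi>_def by simp
    show "\<bar>\<Phi> x\<bar> \<le> 1 / 2" for x by (auto simp: \<Phi>_def)
    show "AE x in lborel. \<Phi> (- x) = - \<Phi> x"
      using e AE_lborel_uminus[OF e] \<open>AE x in lborel. \<Psi> (- x) = - \<Psi> x\<close>
      by eventually_elim simp
    show "AE x in lborel. \<Phi> (x + p) = \<Phi> x"
      using e AE_lborel_translate[OF e, of p] \<open>AE x in lborel. \<Psi> (x + p) = \<Psi> x\<close>
      by eventually_elim simp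
  qed
qed

lemma kernel_integrand_measurable:
  assumes "\<Psi> \<in> borel_measurable M" "sets borel \<subseteq> sets M" "space M = UNIV"
  shows "kernel_integrand \<Psi> w \<in> borel_measurable M"
proof -
  have "id \<in> measurable M borel" using assms by (auto simp: measurable_def)
  then have "sech_pair w 0 \<circ> id \<in> borel_measurable M" by (rule measurable_comp) simp
  then have [measurable]: "sech_pair w 0 \<in> borel_measurable M" by simp
  note assms(1)[measurable]
  show ?thesis unfolding kernel_integrand_eq[abs_def] by measurable
qed

text \<open>Changing \<Psi> on a null set affects neither integrability of the kernel nor the
  integral, and completing the measure does not change integrals of Borel functions. Hence any
  bounded Borel representative computes \<open>S_of\<close>.\<close>

lemma
  assumes \<Psi>: "\<Psi> \<in> borel_measurable lebesgue" and \<Phi>: "\<Phi> \<in> borel_measurable borel" "\<And>x. \<bar>\<Phi> x\<bar> \<le> M"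
    and e: "AE x in lborel. \<Psi> x = \<Phi> x"
  shows integrable_kernel_lebesgue: "w \<in> strip \<Longrightarrow> integrable lebesgue (kernel_integrand \<Psi> w)"
    and S_of_eq_pot: "S_of \<Psi> = (\<lambda>w\<in>strip. pot \<Phi> w)"
proof -
  have m1: "kernel_integrand \<Psi> w \<in> borel_measurable lebesgue" for w
    by (rule kernel_integrand_measurable[OF \<Psi>]) auto
  have m2: "kernel_integrand \<Phi> w \<in> borel_measurable lborel" for w
    by (rule kernel_integrand_measurable) (use \<Phi> in auto)
  have m3: "kernel_integrand \<Phi> w \<in> borel_measurable lebesgue" for w
    using m2 by (rule measurable_completion)
  have e2: "AE x in lebesgue. kernel_integrand \<Phi> w x = kernel_integrand \<Psi> w x" for w
    using AE_completion[OF e] by eventually_elim (simp add: kernel_integrand_def)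
  show "integrable lebesgue (kernel_integrand \<Psi> w)" if w: "w \<in> strip"
    by (rule integrable_cong_AE_imp[OF _ m1 e2]) (use integrable_completion[OF m2] integrable_kernel[OF \<Phi> w] in blast)
  show "S_of \<Psi> = (\<lambda>w\<in>strip. pot \<Phi> w)"
    unfolding S_of_def pot_def integral_completion[OF m2, symmetric]
    by (intro restrict_ext arg_cong[where f = "(*) (1 / 2)"] integral_cong_AE[OF m1 m3]) (use e2 in \<open>simp add: eq_commute\<close>)
qed

text \<open>Under x \<mapsto> - x the sign from \<Phi> cancels the sign from sinh (- w / 2), while
  both cosh factors are unchanged.\<close>

lemma pot_even:
  assumes \<Phi>: "\<Phi> \<in> borel_measurable borel" and odd: "AE x in lborel. \<Phi> (- x) = - \<Phi> x"
  shows "pot \<Phi> (- w) = pot \<Phi> w"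
proof -
  have m: "kernel_integrand \<Phi> w \<in> borel_measurable lborel" for w
    by (rule kernel_integrand_measurable) (use \<Phi> in auto)
  have "(LINT x|lborel. kernel_integrand \<Phi> (- w) x) = (LINT x|lborel. kernel_integrand \<Phi> (- w) (- x))"
    using lborel_integral_real_affine[of "-1" "kernel_integrand \<Phi> (- w)" 0] by simp
  also have "\<dots> = (LINT x|lborel. kernel_integrand \<Phi> w x)"
  proof (rule integral_cong_AE[OF _ m])
    have "(\<lambda>x. kernel_integrand \<Phi> (- w) (- x)) = (\<lambda>x. kernel_integrand \<Phi> (- w) x) \<circ> uminus" by auto
    moreover have "\<dots> \<in> borel_measurable lborel" by (rule measurable_comp[OF _ m]) simp
    ultimately show "(\<lambda>x. kernel_integrand \<Phi> (- w) (- x)) \<in> borel_measurable lborel" by simp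
    show "AE x in lborel. kernel_integrand \<Phi> (- w) (- x) = kernel_integrand \<Phi> w x"
      using odd
    proof eventually_elim
      case (elim x)
      have "(- w + complex_of_real x) / 2 = - ((w - of_real x) / 2)" by (simp add: field_simps)
      then have "cosh ((- w + complex_of_real x) / 2) = cosh ((w - of_real x) / 2)" by (simp only: cosh_minus)
      then show ?case by (simp add: kernel_integrand_def elim)
    qed
  qed
  finally show ?thesis by (simp add: pot_def)
qed

text \<open>The kernel is not translation invariant, because of its factor cosh (x / 2), but the
  integrals for differences of \<open>pot\<close> are. So pot (w + p) - pot w is a constant, and
  evenness shows that it vanishes at one suitable point.\<close>

lemma pot_periodic:
  assumes \<Phi>: "\<Phi> \<in> borel_measurable borel" "\<And>x. \<bar>\<Phi> x\<bar> \<le> M" and odd: "AE x in lborel. \<Phi> (- x) = - \<Phi> x"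
    and per: "AE x in lborel. \<Phi> (x + p) = \<Phi> x" and w: "w \<in> strip"
  shows "pot \<Phi> (w + of_real p) = pot \<Phi> w"
proof -
  \<comment> \<open>At w' = - p / 2 the translate w' + p equals - w', so evenness gives the value 0
    of the constant.\<close>
  define w' where "w' = complex_of_real (- (p / 2))"
  have w': "w' \<in> strip" by (simp add: w'_def strip_def)
  note [measurable] = \<Phi>(1)
  have sh: "sech_pair (w + of_real p) (w' + of_real p) (x + p) = sech_pair w w' x" for x
    by (simp add: sech_pair_def)
  have "(LINT x|lborel. of_real (\<Phi> x) * sech_pair (w + of_real p) (w' + of_real p) x)
     = (LINT x|lborel. of_real (\<Phi> (x + p)) * sech_pair w w' x)"
    using lborel_integral_real_affine[of 1 "\<lambda>x. of_real (\<Phi> x) * sech_pair (w + of_real p) (w' + of_real p) x" p]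
    by (simp add: sh add.commute[of p])
  also have "\<dots> = (LINT x|lborel. of_real (\<Phi> x) * sech_pair w w' x)"
    by (rule integral_cong_AE) (use per in auto)
  finally have J: "(LINT x|lborel. of_real (\<Phi> x) * sech_pair (w + of_real p) (w' + of_real p) x)
     = (LINT x|lborel. of_real (\<Phi> x) * sech_pair w w' x)" .
  have "pot \<Phi> (w + of_real p) - pot \<Phi> (w' + of_real p) = pot \<Phi> w - pot \<Phi> w'"
    unfolding pot_diff[OF \<Phi> w w'] pot_diff[OF \<Phi> add_real_in_strip[OF w] add_real_in_strip[OF w']] J
    by simp
  moreover have "w' + of_real p = - w'" by (simp add: w'_def complex_eq_iff)
  ultimately show ?thesis using pot_even[OF \<Phi>(1) odd, of w'] by simp
qed

text \<open>The constant is the product of the prefactor 1 / 2, the bound 1 / 2 on \<Phi>, and the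
  mass 2 Im w of the nonnegative Poisson kernel; on the real axis the kernel vanishes.\<close>

lemma pot_Im_bound:
  assumes \<Phi>: "\<Phi> \<in> borel_measurable borel" "\<And>x. \<bar>\<Phi> x\<bar> \<le> 1 / 2" and w: "0 \<le> Im w" "Im w < pi"
  shows "\<bar>Im (pot \<Phi> w)\<bar> \<le> 1 / 2 * Im w"
proof -
  have ws: "w \<in> strip" using w pi_gt_zero unfolding strip_def by simp
  show ?thesis
  proof (cases "Im w = 0")
    case True
    then show ?thesis using Im_pot(2)[OF \<Phi> ws] by (simp add: poisson_def)
  next
    case False
    then have v: "0 < Im w" "Im w < pi" using w by auto
    have P: "has_bochner_integral lborel (\<lambda>y. poisson (Im w) (Re w - y)) (2 * Im w)"
      using lborel_has_bochner_integral_real_affine_iff[of "-1" "poisson (Im w)" "2 * Im w" "Re w"]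
        has_bochner_integral_poisson[OF v] by simp
    have "\<bar>LINT x|lborel. \<Phi> x * poisson (Im w) (Re w - x)\<bar> \<le> (LINT x|lborel. \<bar>\<Phi> x * poisson (Im w) (Re w - x)\<bar>)"
      by (rule integral_abs_bound)
    also have "\<dots> \<le> (LINT x|lborel. 1 / 2 * poisson (Im w) (Re w - x))"
    proof (rule integral_mono)
      show "integrable lborel (\<lambda>x. \<bar>\<Phi> x * poisson (Im w) (Re w - x)\<bar>)"
        using Im_pot(1)[OF \<Phi> ws] by (rule integrable_abs)
      show "integrable lborel (\<lambda>x. 1 / 2 * poisson (Im w) (Re w - x))"
        using P by (intro integrable_mult_right) (simp add: has_bochner_integral_iff)
      show "\<bar>\<Phi> x * poisson (Im w) (Re w - x)\<bar> \<le> 1 / 2 * poisson (Im w) (Re w - x)" for x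
        unfolding abs_mult abs_of_nonneg[OF poisson_nonneg[OF v]]
        by (rule mult_right_mono[OF \<Phi>(2) poisson_nonneg[OF v]])
    qed
    also have "\<dots> = Im w" using P by (simp add: has_bochner_integral_iff)
    finally show ?thesis by (simp add: Im_pot(2)[OF \<Phi> ws])
  qed
qed

lemma S_of_in_W:
  assumes \<Psi>: "\<Psi> \<in> Psi_fun p"
  shows "S_of \<Psi> \<in> W p"
proof -
  obtain \<Phi> where \<Phi>: "\<Phi> \<in> borel_measurable borel" "\<And>x. \<bar>\<Phi> x\<bar> \<le> 1 / 2" "AE x in lborel. \<Psi> x = \<Phi> x"
    "AE x in lborel. \<Phi> (- x) = - \<Phi> x" "AE x in lborel. \<Phi> (x + p) = \<Phi> x"
    using Psi_fun_borel_representative[OF \<Psi>] by blast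
  have S: "S_of \<Psi> = (\<lambda>w\<in>strip. pot \<Phi> w)"
    using \<Psi> by (intro S_of_eq_pot[OF _ \<Phi>(1,2,3)]) (simp add: Psi_fun_def Linfty_def)
  have "S_of \<Psi> holomorphic_on strip"
    by (rule holomorphic_transform[OF holomorphic_pot[OF \<Phi>(1,2)]]) (simp add: S)
  then have an: "S_of \<Psi> analytic_on strip"
    by (simp add: analytic_on_open[OF open_strip])
  have strip: "w \<in> strip" if "0 \<le> Im w \<and> Im w < pi" for w
    using that pi_gt_zero unfolding strip_def by simp
  show ?thesis
    unfolding W_def
  proof (intro CollectI conjI allI impI ballI)
    show "S_of \<Psi> \<in> extensional strip" by (simp add: S)
    show "S_of \<Psi> analytic_on strip" by (rule an)
    show "\<bar>Im (S_of \<Psi> w)\<bar> \<le> 1 / 2 * Im w" if "0 \<le> Im w \<and> Im w < pi" for w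
      using pot_Im_bound[OF \<Phi>(1,2)] strip[OF that] that by (simp add: S)
    show "S_of \<Psi> 0 = 0" by (simp add: S pot_def kernel_integrand_def)
    show "S_of \<Psi> (- w) = S_of \<Psi> w" if "w \<in> strip" for w
      using that uminus_in_strip[OF that] pot_even[OF \<Phi>(1,4)] by (simp add: S)
    show "S_of \<Psi> (w + of_real p) = S_of \<Psi> w" if "w \<in> strip" for w
      using that add_real_in_strip[OF that] pot_periodic[OF \<Phi>(1,2,4,5) that] by (simp add: S)
  qed
qed

text \<open>The limit sees only points inside the strip. This matters because \<open>S_of\<close> is
  undefined outside the strip while \<open>pot\<close> is not restricted.\<close>

lemma tendsto_strip_cong:
  assumes "\<And>w. w \<in> strip \<Longrightarrow> S w = S' w"
  shows "((\<lambda>\<mu>. 1 / pi * Im (S (of_real x + \<i> * of_real \<mu>))) \<longlongrightarrow> l) (at_left pi)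
     \<longleftrightarrow> ((\<lambda>\<mu>. 1 / pi * Im (S' (of_real x + \<i> * of_real \<mu>))) \<longlongrightarrow> l) (at_left pi)"
proof (rule filterlim_cong[OF refl refl])
  have "eventually (\<lambda>v::real. 0 < v \<and> v < pi) (at_left pi)"
    by (subst eventually_at_left[of 0]) (auto intro!: exI[of _ 0])
  then show "eventually (\<lambda>\<mu>. 1 / pi * Im (S (of_real x + \<i> * of_real \<mu>)) = 1 / pi * Im (S' (of_real x + \<i> * of_real \<mu>))) (at_left pi)"
    by eventually_elim (simp add: assms strip_def)
qed

lemma Psi_fun_boundary_limit:
  assumes \<Psi>: "\<Psi> \<in> Psi_fun p"
  shows "AE x in lebesgue. ((\<lambda>\<mu>. 1 / pi * Im (S_of \<Psi> (of_real x + \<i> * of_real \<mu>))) \<longlongrightarrow> \<Psi> x) (at_left pi)"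
proof -
  obtain \<Phi> where \<Phi>: "\<Phi> \<in> borel_measurable borel" "\<And>x. \<bar>\<Phi> x\<bar> \<le> 1 / 2" "AE x in lborel. \<Psi> x = \<Phi> x"
    using Psi_fun_borel_representative[OF \<Psi>] by blast
  have S: "S_of \<Psi> = (\<lambda>w\<in>strip. pot \<Phi> w)"
    using \<Psi> by (intro S_of_eq_pot[OF _ \<Phi>]) (simp add: Psi_fun_def Linfty_def)
  have "AE x in lborel. ((\<lambda>\<mu>. 1 / pi * Im (S_of \<Psi> (of_real x + \<i> * of_real \<mu>))) \<longlongrightarrow> \<Psi> x) (at_left pi)"
    using AE_tendsto_Im_pot[OF \<Phi>(1,2)] \<Phi>(3)
  proof eventually_elim
    case (elim x)
    then show ?case by (subst tendsto_strip_cong[where S' = "pot \<Phi>"]) (auto simp: S)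
  qed
  then show ?thesis by (rule AE_completion)
qed

lemma Psi_fun_S_of_inj:
  assumes "\<Psi> \<in> Psi_fun p" "\<Phi> \<in> Psi_fun p" "S_of \<Phi> = S_of \<Psi>"
  shows "AE x in lebesgue. \<Phi> x = \<Psi> x"
  using Psi_fun_boundary_limit[OF assms(1)] Psi_fun_boundary_limit[OF assms(2)]
  unfolding assms(3)
proof eventually_elim
  case (elim x)
  show ?case by (rule tendsto_unique[OF trivial_limit_at_left_real elim(2) elim(1)])
qed

text \<open>Since \<Phi> is almost everywhere the boundary limit of Im S / pi, each symmetry of S
  gives the corresponding one of \<Phi>: the limit is taken both at x and at -x, or at x + p,
  outside a null set, and limits are unique.\<close>

lemma W_surj:
  assumes S: "S \<in> W p" and p: "0 < p"
  obtains \<Psi> where "\<Psi> \<in> Psi_fun p" "S_of \<Psi> = S"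
proof -
  obtain \<Phi> where \<Phi>: "\<Phi> \<in> borel_measurable borel" "\<And>x. \<bar>\<Phi> x\<bar> \<le> 1 / 2"
    and pot: "\<And>w. w \<in> strip \<Longrightarrow> S w = pot \<Phi> w"
    using W_eq_pot[OF S p] by blast
  let ?L = "\<lambda>x l. ((\<lambda>\<mu>. 1 / pi * Im (S (of_real x + \<i> * of_real \<mu>))) \<longlongrightarrow> l) (at_left pi)"
  have lim: "AE x in lborel. ?L x (\<Phi> x)"
    using AE_tendsto_Im_pot[OF \<Phi>] by eventually_elim (subst tendsto_strip_cong[OF pot])
  have ev: "eventually (\<lambda>v::real. 0 < v \<and> v < pi) (at_left pi)"
    by (subst eventually_at_left[of 0]) (auto intro!: exI[of _ 0])
  have odd: "AE x in lborel. \<Phi> (- x) = - \<Phi> x"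
    using lim AE_lborel_uminus[OF lim]
  proof eventually_elim
    case (elim x)
    have "eventually (\<lambda>\<mu>. 1 / pi * Im (S (of_real (- x) + \<i> * of_real \<mu>)) = - (1 / pi * Im (S (of_real x + \<i> * of_real \<mu>)))) (at_left pi)"
      using ev
    proof eventually_elim
      case (elim v)
      let ?w = "of_real x + \<i> * of_real v :: complex"
      have w: "?w \<in> strip" using elim by (simp add: strip_def)
      have e: "of_real (- x) + \<i> * of_real v = - cnj ?w" by simp
      have "S (- cnj ?w) = S (cnj ?w)" using S cnj_in_strip[OF w] unfolding W_def by blast
      then have "S (of_real (- x) + \<i> * of_real v) = cnj (S ?w)"
        unfolding e W_cnj[OF S w] .
      then show ?case by simp
    qed
    then have "?L (- x) (- \<Phi> x) \<longleftrightarrow> ((\<lambda>\<mu>. - (1 / pi * Im (S (of_real x + \<i> * of_real \<mu>)))) \<longlongrightarrow> - \<Phi> x) (at_left pi)"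
      by (rule filterlim_cong[OF refl refl])
    then have "?L (- x) (- \<Phi> x)" using tendsto_minus[OF elim(1)] by blast
    with elim(2) show ?case by (rule tendsto_unique[OF trivial_limit_at_left_real])
  qed
  have per: "AE x in lborel. \<Phi> (x + p) = \<Phi> x"
    using lim AE_lborel_translate[OF lim, of p]
  proof eventually_elim
    case (elim x)
    have "eventually (\<lambda>\<mu>. 1 / pi * Im (S (of_real (x + p) + \<i> * of_real \<mu>)) = 1 / pi * Im (S (of_real x + \<i> * of_real \<mu>))) (at_left pi)"
      using ev
    proof eventually_elim
      case (elim v)
      let ?w = "of_real x + \<i> * of_real v :: complex"
      have w: "?w \<in> strip" using elim by (simp add: strip_def)
      have "of_real (x + p) + \<i> * of_real v = ?w + of_real p" by simp
      moreover have "S (?w + of_real p) = S ?w" using S w by (auto simp: W_def)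
      ultimately show ?case by metis
    qed
    then have "?L (x + p) (\<Phi> x) \<longleftrightarrow> ?L x (\<Phi> x)"
      by (rule filterlim_cong[OF refl refl])
    then have "?L (x + p) (\<Phi> x)" using elim(1) by blast
    with elim(2) show ?case by (rule tendsto_unique[OF trivial_limit_at_left_real])
  qed
  have m: "\<Phi> \<in> borel_measurable lebesgue" using \<Phi>(1) by (simp add: measurable_completion)
  have norm: "Linfty_norm \<Phi> \<le> ereal (1 / 2)"
    unfolding Linfty_norm_def
  proof (rule esssup_I)
    show "(\<lambda>x. ereal \<bar>\<Phi> x\<bar>) \<in> borel_measurable lebesgue" using m by simp
    show "AE x in lebesgue. ereal \<bar>\<Phi> x\<bar> \<le> ereal (1 / 2)" using \<Phi>(2) by (intro AE_I2) simp
  qed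
  also have "\<dots> < \<infinity>" by simp
  finally have "\<Phi> \<in> Linfty" using m by (simp add: Linfty_def)
  then have "\<Phi> \<in> Psi_fun p"
    using norm AE_completion[OF odd] AE_completion[OF per] by (simp add: Psi_fun_def)
  moreover have "S_of \<Phi> = S"
  proof -
    have "S_of \<Phi> = (\<lambda>w\<in>strip. pot \<Phi> w)" by (rule S_of_eq_pot[OF m \<Phi>]) simp
    also have "\<dots> = (\<lambda>w\<in>strip. S w)" by (rule restrict_ext) (simp add: pot)
    also have "\<dots> = S" using S by (simp add: W_def extensional_restrict)
    finally show ?thesis .
  qed
  ultimately show thesis by (rule that)
qed

text \<open>All members of the class share the Borel representative \<Phi> of \<Psi>, so the image
  of the class under \<open>S_of\<close> is a singleton and \<open>the_elem\<close> returns its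
  element.\<close>

lemma S_of_class_eq:
  assumes \<Psi>: "\<Psi> \<in> Psi_fun p"
  shows "S_of_class (ae_rel `` {\<Psi>}) = S_of \<Psi>"
proof -
  obtain \<Phi> where \<Phi>: "\<Phi> \<in> borel_measurable borel" "\<And>x. \<bar>\<Phi> x\<bar> \<le> 1 / 2" "AE x in lborel. \<Psi> x = \<Phi> x"
    using Psi_fun_borel_representative[OF \<Psi>] by blast
  have L: "\<Psi> \<in> Linfty" using \<Psi> by (simp add: Psi_fun_def)
  have "S_of f = S_of \<Psi>" if f: "f \<in> ae_rel `` {\<Psi>}" for f
  proof -
    have fL: "f \<in> Linfty" and "AE x in lebesgue. \<Psi> x = f x" using f by (auto simp: ae_rel_def)
    then have "AE x in lborel. \<Psi> x = f x" by (simp add: AE_completion_iff)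
    with \<Phi>(3) have "AE x in lborel. f x = \<Phi> x" by eventually_elim simp
    then show ?thesis using S_of_eq_pot[OF _ \<Phi>] S_of_eq_pot[OF _ \<Phi>(1,2)] fL L by (simp add: Linfty_def)
  qed
  moreover have "\<Psi> \<in> ae_rel `` {\<Psi>}" using L by (simp add: ae_rel_def)
  moreover have "S_of ` X = {S_of \<Psi>}" if "\<And>f. f \<in> X \<Longrightarrow> S_of f = S_of \<Psi>" "\<Psi> \<in> X" for X
    by (intro equalityI image_subsetI singleton_iff[THEN iffD2] that(1) insert_subsetI imageI that(2) empty_subsetI)
  ultimately have "S_of ` (ae_rel `` {\<Psi>}) = {S_of \<Psi>}" by blast
  then show ?thesis by (simp add: S_of_class_def)
qed

lemma ae_rel_class_eq:
  assumes "\<Psi> \<in> Linfty" "\<Phi> \<in> Linfty" and e: "AE x in lebesgue. \<Phi> x = \<Psi> x"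
  shows "ae_rel `` {\<Phi>} = ae_rel `` {\<Psi>}"
proof -
  have "(AE x in lebesgue. \<Phi> x = f x) \<longleftrightarrow> (AE x in lebesgue. \<Psi> x = f x)" for f
  proof
    assume "AE x in lebesgue. \<Phi> x = f x"
    with e show "AE x in lebesgue. \<Psi> x = f x" by eventually_elim simp
  next
    assume "AE x in lebesgue. \<Psi> x = f x"
    with e show "AE x in lebesgue. \<Phi> x = f x" by eventually_elim simp
  qed
  then show ?thesis using assms by (auto simp: ae_rel_def)
qed

text \<open>Integrability is asserted separately because a Bochner integral is 0 by convention when
  the integrand is not integrable. The clause on \<open>S_of_class\<close> certifies that the map in
  the bijection is really induced by \<open>S_of\<close>, as \<open>the_elem\<close> is unspecified
  off singletons.\<close>

theorem theorem16:
  fixes p :: real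
  assumes "p > 0"
  shows "(\<forall>\<Psi>\<in>Psi_fun p. (\<forall>w\<in>strip. integrable lebesgue (kernel_integrand \<Psi> w)) \<and> S_of \<Psi> \<in> W p)
    \<and> (\<forall>\<Psi>\<in>Psi_fun p. S_of_class (ae_rel `` {\<Psi>}) = S_of \<Psi>)
    \<and> bij_betw S_of_class (Psi_fun p // ae_rel) (W p)
    \<and> (\<forall>S\<in>W p. \<exists>\<Psi>\<in>Psi_fun p. S_of \<Psi> = S
          \<and> (\<forall>\<Phi>\<in>Psi_fun p. S_of \<Phi> = S \<longrightarrow> (AE x in lebesgue. \<Phi> x = \<Psi> x))
          \<and> (AE x in lebesgue.
               ((\<lambda>\<mu>. 1 / pi * Im (S (of_real x + \<i> * of_real \<mu>))) \<longlongrightarrow> \<Psi> x) (at_left pi)))"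
proof (intro conjI ballI)
  fix \<Psi> w assume \<Psi>: "\<Psi> \<in> Psi_fun p" and w: "w \<in> strip"
  obtain \<Phi> where \<Phi>: "\<Phi> \<in> borel_measurable borel" "\<And>x. \<bar>\<Phi> x\<bar> \<le> 1 / 2" "AE x in lborel. \<Psi> x = \<Phi> x"
    using Psi_fun_borel_representative[OF \<Psi>] by blast
  show "integrable lebesgue (kernel_integrand \<Psi> w)"
    using \<Psi> by (intro integrable_kernel_lebesgue[OF _ \<Phi> w]) (simp add: Psi_fun_def Linfty_def)
next
  show "bij_betw S_of_class (Psi_fun p // ae_rel) (W p)"
  proof (rule bij_betw_imageI)
    show "inj_on S_of_class (Psi_fun p // ae_rel)"
    proof (rule inj_onI)
      fix C C' assume "C \<in> Psi_fun p // ae_rel" "C' \<in> Psi_fun p // ae_rel" and eq: "S_of_class C = S_of_class C'"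
      then obtain \<Psi> \<Phi> where C: "\<Psi> \<in> Psi_fun p" "C = ae_rel `` {\<Psi>}" "\<Phi> \<in> Psi_fun p" "C' = ae_rel `` {\<Phi>}"
        by (auto elim!: quotientE)
      then have "S_of \<Phi> = S_of \<Psi>" using eq by (simp add: S_of_class_eq)
      then have "AE x in lebesgue. \<Phi> x = \<Psi> x" using C by (intro Psi_fun_S_of_inj)
      then show "C = C'" using C ae_rel_class_eq[of \<Psi> \<Phi>] by (simp add: Psi_fun_def)
    qed
    show "S_of_class ` (Psi_fun p // ae_rel) = W p"
    proof (intro equalityI subsetI)
      fix S assume "S \<in> S_of_class ` (Psi_fun p // ae_rel)"
      then obtain \<Psi> where "\<Psi> \<in> Psi_fun p" "S = S_of_class (ae_rel `` {\<Psi>})" by (auto elim!: quotientE)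
      then show "S \<in> W p" by (simp add: S_of_class_eq S_of_in_W)
    next
      fix S assume "S \<in> W p"
      then obtain \<Psi> where "\<Psi> \<in> Psi_fun p" "S_of \<Psi> = S" using W_surj[OF _ assms] by blast
      then show "S \<in> S_of_class ` (Psi_fun p // ae_rel)"
        by (intro image_eqI[of _ _ "ae_rel `` {\<Psi>}"]) (simp_all add: S_of_class_eq quotientI)
    qed
  qed
next
  fix S assume "S \<in> W p"
  then obtain \<Psi> where \<Psi>: "\<Psi> \<in> Psi_fun p" "S_of \<Psi> = S" using W_surj[OF _ assms] by blast
  show "\<exists>\<Psi>\<in>Psi_fun p. S_of \<Psi> = S
          \<and> (\<forall>\<Phi>\<in>Psi_fun p. S_of \<Phi> = S \<longrightarrow> (AE x in lebesgue. \<Phi> x = \<Psi> x))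
          \<and> (AE x in lebesgue.
               ((\<lambda>\<mu>. 1 / pi * Im (S (of_real x + \<i> * of_real \<mu>))) \<longlongrightarrow> \<Psi> x) (at_left pi))"
  proof (intro bexI[of _ \<Psi>] conjI ballI impI)
    show "AE x in lebesgue. \<Phi> x = \<Psi> x" if "\<Phi> \<in> Psi_fun p" "S_of \<Phi> = S" for \<Phi>
      using that \<Psi> by (intro Psi_fun_S_of_inj) auto
    show "AE x in lebesgue. ((\<lambda>\<mu>. 1 / pi * Im (S (of_real x + \<i> * of_real \<mu>))) \<longlongrightarrow> \<Psi> x) (at_left pi)"
      using Psi_fun_boundary_limit[OF \<Psi>(1)] by (simp only: \<Psi>(2))
  qed (use \<Psi> in auto)
qed (rule S_of_in_W S_of_class_eq, assumption)+

end
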